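(* Let $a\in L^\infty(\mathbb{T})$ be such that the Toeplitz operator $T_a f = P(af)$ is bounded on the Hardy space $H^1$. Then $a$ has no jump discontinuities; that is, there is no point $t\in\mathbb{T}$ at which both one-sided limits $a(t-0)$ and $a(t+0)$ exist and satisfy $a(t-0)\neq a(t+0)$.
   Context: $\mathbb{T}$ is the unit circle in $\mathbb{C}$ and $L^p=L^p(\mathbb{T})$ (complex-valued functions, with respect to arc length measure). For $f\in L^1$, $f_k$ denotes the $k$th Fourier coefficient of $f$. For $1\le p\le\infty$, the Hardy space is $H^p=\{f\in L^p : f_k=0 \text{ for all } k<0\}$, with the $L^p$ norm. $P$ denotes the Riesz projection, i.e. the orthogonal projection of $L^2$ onto $H^2$ (it is not bounded on $L^1$). For $a\in L^\infty$ the Toeplitz operator with symbol $a$ is $T_a f=P(af)$, which is well defined as an element of $H^2\subset H^1$ for every $f$ in the dense subspace $H^2$ of $H^1$. "$T_a$ is bounded on $H^1$" means that there is a constant $C$ with $\|P(af)\|_{L^1}\le C\|f\|_{L^1}$ for all $f\in H^2$ (equivalently, $T_a$ extends to a bounded linear operator on $H^1$). One-sided limits of the (equivalence class of the) function $a$ at $t\in\mathbb{T}$ are understood as essential limits: $a(t+0)=c$ means that the essential supremum of $|a(te^{i\theta})-c|$ over $0<\theta<\delta$ tends to $0$ as $\delta\to0^+$, and $a(t-0)=c$ means the same with $-\delta<\theta<0$. *)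

theory Defs
  imports "HOL-Analysis.Analysis" "HOL-Probability.Essential_Supremum"
begin

text \<open>Arc length measure on the unit circle, of total mass \<open>2\<pi>\<close>. Functions on the circle are
  maps \<open>complex \<Rightarrow> complex\<close>, of which only the values on \<^term>\<open>sphere 0 1 :: complex set\<close> matter;
  elements of the Lebesgue spaces are Borel representatives of the usual equivalence classes.\<close>

definition arc_length :: "complex measure" where
  "arc_length =
     distr (restrict_space lborel {0..<2 * pi}) (restrict_space borel (sphere 0 1)) cis"

lemma measurable_cis_arc_length:
  "cis \<in> restrict_space lborel {0..<2 * pi} \<rightarrow>\<^sub>M restrict_space borel (sphere 0 1)"
proof (rule measurable_restrict_space2)
  show "cis \<in> restrict_space lborel {0..<2 * pi} \<rightarrow>\<^sub>M borel"
    by (intro measurable_restrict_space1)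
      (simp add: borel_measurable_continuous_onI continuous_on_cis)
qed auto

lemma space_arc_length: "space arc_length = sphere 0 1"
  and sets_arc_length: "sets arc_length = sets (restrict_space borel (sphere 0 1))"
  by (simp_all add: arc_length_def space_restrict_space)

lemma emeasure_arc_length_space: "emeasure arc_length (space arc_length) = ennreal (2 * pi)"
proof -
  have "emeasure arc_length (space arc_length)
      = emeasure (restrict_space lborel {0..<2 * pi}) {0..<2 * pi}"
    unfolding space_arc_length unfolding arc_length_def
    by (subst emeasure_distr[OF measurable_cis_arc_length])
      (auto simp: sets_restrict_space space_restrict_space intro!: arg_cong2[where f=emeasure])
  also have "\<dots> = ennreal (2 * pi)"
    by (subst emeasure_restrict_space) auto
  finally show ?thesis .
qed

definition circle_Lp :: "real \<Rightarrow> (complex \<Rightarrow> complex) set" where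
  "circle_Lp p = {f \<in> borel_measurable arc_length.
     integrable arc_length (\<lambda>z. norm (f z) powr p)}"

definition circle_Lp_norm :: "real \<Rightarrow> (complex \<Rightarrow> complex) \<Rightarrow> real" where
  "circle_Lp_norm p f = (LINT z|arc_length. norm (f z) powr p) powr (1 / p)"

definition circle_Linfty :: "(complex \<Rightarrow> complex) set" where
  "circle_Linfty = {f \<in> borel_measurable arc_length.
     esssup arc_length (\<lambda>z. ereal (norm (f z))) < \<infinity>}"

definition fourier_coeff :: "(complex \<Rightarrow> complex) \<Rightarrow> int \<Rightarrow> complex" where
  "fourier_coeff f k = (LINT z|arc_length. f z * z powi (- k)) / complex_of_real (2 * pi)"

definition hardy :: "real \<Rightarrow> (complex \<Rightarrow> complex) set" where
  "hardy p = {f \<in> circle_Lp p. \<forall>k<0. fourier_coeff f k = 0}"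

text \<open>The orthogonal projection of \<open>L\<^sup>2\<close> onto \<open>H\<^sup>2\<close>: the element of \<open>H\<^sup>2\<close>, unique almost
  everywhere, whose difference from \<open>f\<close> is orthogonal to \<open>H\<^sup>2\<close>. The choice operator only selects
  a representative.\<close>

definition riesz_projection :: "(complex \<Rightarrow> complex) \<Rightarrow> complex \<Rightarrow> complex" where
  "riesz_projection f = (SOME g. g \<in> hardy 2 \<and>
     (\<forall>h \<in> hardy 2. (LINT z|arc_length. (f z - g z) * cnj (h z)) = 0))"

definition toeplitz :: "(complex \<Rightarrow> complex) \<Rightarrow> (complex \<Rightarrow> complex) \<Rightarrow> complex \<Rightarrow> complex" where
  "toeplitz a f = riesz_projection (\<lambda>z. a z * f z)"

text \<open>Boundedness on \<open>H\<^sup>1\<close> is tested on the dense subspace \<open>H\<^sup>2\<close>, where \<^const>\<open>toeplitz\<close> is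
  defined.\<close>

definition toeplitz_bounded_H1 :: "(complex \<Rightarrow> complex) \<Rightarrow> bool" where
  "toeplitz_bounded_H1 a \<longleftrightarrow>
     (\<exists>C. \<forall>f \<in> hardy 2. circle_Lp_norm 1 (toeplitz a f) \<le> C * circle_Lp_norm 1 f)"

definition ess_right_limit :: "(complex \<Rightarrow> complex) \<Rightarrow> complex \<Rightarrow> complex \<Rightarrow> bool" where
  "ess_right_limit a t c \<longleftrightarrow>
     ((\<lambda>\<delta>. esssup (restrict_space lborel {0<..<\<delta>}) (\<lambda>\<theta>. ereal (norm (a (t * cis \<theta>) - c))))
       \<longlongrightarrow> 0) (at_right 0)"

definition ess_left_limit :: "(complex \<Rightarrow> complex) \<Rightarrow> complex \<Rightarrow> complex \<Rightarrow> bool" where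
  "ess_left_limit a t c \<longleftrightarrow>
     ((\<lambda>\<delta>. esssup (restrict_space lborel {-\<delta><..<0}) (\<lambda>\<theta>. ereal (norm (a (t * cis \<theta>) - c))))
       \<longlongrightarrow> 0) (at_right 0)"

definition jump_discontinuity_at :: "(complex \<Rightarrow> complex) \<Rightarrow> complex \<Rightarrow> bool" where
  "jump_discontinuity_at a t \<longleftrightarrow>
     (\<exists>c d. ess_left_limit a t c \<and> ess_right_limit a t d \<and> c \<noteq> d)"

end

theory Submission
  imports Defs "HOL-Probability.Sinc_Integral" "HOL-Real_Asymp.Real_Asymp"
begin

text \<open>
  Suppose \<open>a\<close> jumps at \<open>t\<close> from \<open>c\<close> to \<open>d\<close>. For small \<open>\<epsilon> > 0\<close> put \<open>q = (1 - \<epsilon>) cnj t\<close> and test with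
  \<open>f z = \<epsilon> / (1 - q z)\<^sup>2\<close>, which is bounded in \<open>H\<^sup>1\<close>, and \<open>H z = Ln (1 - q z)\<close>. Since \<open>H\<close> is the Riesz
  projection of the bounded function \<open>H - cnj H\<close>, boundedness of the Toeplitz operator keeps
  \<open>\<integral> a f cnj H\<close> bounded as \<open>\<epsilon> \<rightarrow> 0\<close>. On the scale \<open>z = t cis (\<epsilon> x)\<close>, however, \<open>H\<close> behaves like the constant
  \<open>ln \<epsilon>\<close> and \<open>f z |dz|\<close> like \<open>dx / (1 - i x)\<^sup>2\<close>, whose integrals over the two half-lines are \<open>i\<close> and \<open>- i\<close>.
  Hence \<open>\<integral> a f cnj H\<close> is asymptotic to \<open>i (d - c) ln \<epsilon>\<close>, which forces \<open>c = d\<close>.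
\<close>

section \<open>Square-integrable functions\<close>

text \<open>The absolute value of \<open>f\<close> is the Poisson kernel of the point
  \<open>(1 - \<epsilon>) t\<close> divided by \<open>2 - \<epsilon>\<close>; hence the uniform
  \<open>L^1\<close> bound and the concentration at \<open>t\<close>. Being analytic,
  \<open>f\<close> cannot concentrate there with a fixed sign: its rescaled limit has total integral
  \<open>i + (- i) = 0\<close>. If \<open>a\<close> were continuous at \<open>t\<close>, the leading
  term would cancel, so only the difference of the two one-sided limits is visible. The logarithm
  detects it because the projection does not preserve boundedness: \<open>Im H\<close> is an
  argument and stays bounded, while \<open>Re H\<close> is of size \<open>|ln \<epsilon>|\<close>
  near \<open>t\<close>. Away from \<open>t\<close> only boundedness of \<open>a\<close> is known,
  which after rescaling suffices for dominated convergence with a majorant proportional to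
  \<open>1 / (1 + x^2)\<close>. The one-sided limits are essential ones, so each scale has its own
  null set; this is why the limit is taken along a sequence of scales. Since the projection is given
  by a choice operator, its existence must be proved, which is the purpose of the Hilbert space
  part.\<close>

definition square_integrable :: "'a measure \<Rightarrow> ('a \<Rightarrow> complex) set" where
  "square_integrable M = {f \<in> borel_measurable M. integrable M (\<lambda>x. (cmod (f x))\<^sup>2)}"

lemma square_integrableD:
  assumes "f \<in> square_integrable M"
  shows "f \<in> borel_measurable M" "integrable M (\<lambda>x. (cmod (f x))\<^sup>2)"
  using assms by (auto simp: square_integrable_def)

lemma square_integrable_cmult:
  assumes "f \<in> square_integrable M"
  shows "(\<lambda>x. c * f x) \<in> square_integrable M"
  using assms by (auto simp: square_integrable_def norm_mult power_mult_distrib)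

lemma square_integrable_add:
  assumes "f \<in> square_integrable M" "g \<in> square_integrable M"
  shows "(\<lambda>x. f x + g x) \<in> square_integrable M"
proof -
  note [measurable] = assms[THEN square_integrableD(1)]
  have "integrable M (\<lambda>x. (cmod (f x + g x))\<^sup>2)"
  proof (rule Bochner_Integration.integrable_bound)
    show "integrable M (\<lambda>x. 2 * (cmod (f x))\<^sup>2 + 2 * (cmod (g x))\<^sup>2)"
      using assms
      by (intro Bochner_Integration.integrable_add integrable_mult_right square_integrableD(2))
    show "AE x in M. norm ((cmod (f x + g x))\<^sup>2)
        \<le> norm (2 * (cmod (f x))\<^sup>2 + 2 * (cmod (g x))\<^sup>2)"
    proof (rule AE_I2)
      fix x
      have "(cmod (f x + g x))\<^sup>2 \<le> (cmod (f x) + cmod (g x))\<^sup>2"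
        by (intro power_mono norm_triangle_ineq) auto
      also have "\<dots> \<le> 2 * (cmod (f x))\<^sup>2 + 2 * (cmod (g x))\<^sup>2"
        using sum_squares_bound[of "cmod (f x)" "cmod (g x)"] by (simp add: power2_sum)
      finally show "norm ((cmod (f x + g x))\<^sup>2) \<le> norm (2 * (cmod (f x))\<^sup>2 + 2 * (cmod (g x))\<^sup>2)"
        by simp
    qed
  qed measurable
  then show ?thesis
    by (simp add: square_integrable_def)
qed

lemma square_integrable_diff:
  assumes "f \<in> square_integrable M" "g \<in> square_integrable M"
  shows "(\<lambda>x. f x - g x) \<in> square_integrable M"
  using square_integrable_add[OF assms(1) square_integrable_cmult[OF assms(2), of "-1"]] by simp

lemma borel_measurable_cnj: "cnj \<in> borel_measurable borel"
  by (intro borel_measurable_continuous_onI continuous_intros)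

lemma square_integrable_mult_cnj:
  assumes "f \<in> square_integrable M" "g \<in> square_integrable M"
  shows "integrable M (\<lambda>x. f x * cnj (g x))"
proof -
  note [measurable] = assms[THEN square_integrableD(1)] borel_measurable_cnj
  show ?thesis
  proof (rule Bochner_Integration.integrable_bound)
    show "integrable M (\<lambda>x. (cmod (f x))\<^sup>2 + (cmod (g x))\<^sup>2)"
      using assms by (intro Bochner_Integration.integrable_add square_integrableD(2))
    show "AE x in M. norm (f x * cnj (g x)) \<le> norm ((cmod (f x))\<^sup>2 + (cmod (g x))\<^sup>2)"
    proof (rule AE_I2)
      fix x
      have "2 * (cmod (f x) * cmod (g x)) \<le> (cmod (f x))\<^sup>2 + (cmod (g x))\<^sup>2"
        using sum_squares_bound[of "cmod (f x)" "cmod (g x)"] by simp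
      moreover have "0 \<le> cmod (f x) * cmod (g x)" by simp
      ultimately show "norm (f x * cnj (g x)) \<le> norm ((cmod (f x))\<^sup>2 + (cmod (g x))\<^sup>2)"
        unfolding norm_mult complex_mod_cnj real_norm_def
        by linarith
    qed
  qed measurable
qed

lemma (in finite_measure) square_integrable_integrable:
  assumes "f \<in> square_integrable M"
  shows "integrable M f"
proof -
  note [measurable] = square_integrableD(1)[OF assms]
  have "integrable M (\<lambda>x. cmod (f x))"
    by (rule square_integrable_imp_integrable[OF _ square_integrableD(2)[OF assms]]) measurable
  then show ?thesis
    by (subst (asm) integrable_norm_iff) measurable
qed

text \<open>Cauchy-Schwarz against the constant 1, read off from the non-negative integral of
  \<open>(\<mu> * cmod (f x) - J)^2\<close>. It is the bridge from mean-square to \<open>L^1\<close>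
  estimates.\<close>

lemma (in finite_measure) integral_cmod_power2_le:
  assumes "f \<in> square_integrable M"
  shows "(LINT x|M. cmod (f x))\<^sup>2 \<le> (LINT x|M. (cmod (f x))\<^sup>2) * measure M (space M)"
proof -
  define J where "J = (LINT x|M. cmod (f x))"
  define Q where "Q = (LINT x|M. (cmod (f x))\<^sup>2)"
  define \<mu> where "\<mu> = measure M (space M)"
  have [simp]: "integrable M (\<lambda>x. cmod (f x))"
    using square_integrable_integrable[OF assms] by simp
  have [simp]: "integrable M (\<lambda>x. (cmod (f x))\<^sup>2)"
    using assms by (rule square_integrableD)
  have "J \<ge> 0" "Q \<ge> 0" "\<mu> \<ge> 0"
    by (auto simp: J_def Q_def \<mu>_def intro!: integral_nonneg_AE)
  have "0 \<le> (LINT x|M. (\<mu> * cmod (f x) - J)\<^sup>2)"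
    by (intro integral_nonneg_AE) auto
  also have "\<dots> = (LINT x|M. \<mu>\<^sup>2 * (cmod (f x))\<^sup>2 - 2 * \<mu> * J * cmod (f x) + J\<^sup>2)"
    by (intro Bochner_Integration.integral_cong) (auto simp: power2_eq_square algebra_simps)
  also have "\<dots> = \<mu>\<^sup>2 * Q - 2 * \<mu> * J * J + \<mu> * J\<^sup>2"
    by (simp add: J_def Q_def \<mu>_def)
  also have "\<dots> = \<mu> * (Q * \<mu> - J\<^sup>2)"
    by (simp add: power2_eq_square algebra_simps)
  finally have *: "0 \<le> \<mu> * (Q * \<mu> - J\<^sup>2)" .
  show ?thesis
  \<comment> \<open>The inequality \<open>*\<close> carries a factor \<open>\<mu>\<close> and says
    nothing when it vanishes; on a null space \<open>J = 0\<close> anyway.\<close>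
  proof (cases "\<mu> = 0")
    case True
    then have "emeasure M (space M) = 0"
      by (simp add: \<mu>_def emeasure_eq_measure)
    then have "J = 0"
      unfolding J_def by (intro integral_eq_zero_AE AE_I[of _ _ "space M"]) auto
    then show ?thesis using True by (simp add: J_def \<mu>_def)
  next
    case False
    with * \<open>\<mu> \<ge> 0\<close> have "J\<^sup>2 \<le> Q * \<mu>"
      by (simp add: zero_le_mult_iff)
    then show ?thesis
      by (simp add: J_def Q_def \<mu>_def)
  qed
qed

text \<open>On a finite measure space a mean-square Cauchy sequence is Cauchy in \<open>L^1\<close>,
  so a subsequence converges almost everywhere. Fatou's lemma along that subsequence identifies its
  pointwise limit as the mean-square limit of the full sequence.\<close>

lemma (in finite_measure) square_integrable_complete:
  assumes u: "\<And>n. u n \<in> square_integrable M"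
    and cauchy: "\<And>e. e > 0 \<Longrightarrow> \<exists>N. \<forall>m\<ge>N. \<forall>n\<ge>N. (LINT x|M. (cmod (u m x - u n x))\<^sup>2) \<le> e"
  obtains v where "v \<in> square_integrable M" "(\<lambda>n. LINT x|M. (cmod (u n x - v x))\<^sup>2) \<longlonglongrightarrow> 0"
proof -
  note [measurable] = u[THEN square_integrableD(1)]
  define \<mu> where "\<mu> = measure M (space M)"
  have "\<mu> \<ge> 0" by (simp add: \<mu>_def)
  have L1: "\<exists>N. \<forall>i\<ge>N. \<forall>j\<ge>N. (LINT x|M. norm (u i x - u j x)) < e" if "e > 0" for e
  proof -
    \<comment> \<open>The threshold times \<open>\<mu>\<close> stays below \<open>e\<^sup>2\<close>;
      adding 1 keeps the denominator positive when \<open>\<mu> = 0\<close>.\<close>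
    obtain N where N: "\<And>m n. m \<ge> N \<Longrightarrow> n \<ge> N \<Longrightarrow>
        (LINT x|M. (cmod (u m x - u n x))\<^sup>2) \<le> e\<^sup>2 / (2 * (\<mu> + 1))"
      using cauchy[of "e\<^sup>2 / (2 * (\<mu> + 1))"] \<open>e > 0\<close> \<open>\<mu> \<ge> 0\<close> by auto
    have "(LINT x|M. norm (u i x - u j x)) < e" if "i \<ge> N" "j \<ge> N" for i j
    proof -
      have "(LINT x|M. norm (u i x - u j x))\<^sup>2 \<le> (LINT x|M. (cmod (u i x - u j x))\<^sup>2) * \<mu>"
        unfolding \<mu>_def by (intro integral_cmod_power2_le square_integrable_diff u)
      also have "\<dots> \<le> e\<^sup>2 / (2 * (\<mu> + 1)) * \<mu>"
        using N[OF that] \<open>\<mu> \<ge> 0\<close> by (intro mult_right_mono) auto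
      also have "\<dots> < e\<^sup>2"
        using \<open>e > 0\<close> \<open>\<mu> \<ge> 0\<close> by (simp add: field_simps add_nonneg_pos)
      finally show ?thesis
        by (rule power_less_imp_less_base) (use \<open>e > 0\<close> in auto)
    qed
    then show ?thesis by blast
  qed
  obtain r where r: "strict_mono r" and ae: "AE x in M. Cauchy (\<lambda>i. u (r i) x)"
    by (rule cauchy_L1_AE_cauchy_subseq[of M u])
      (use L1 u in \<open>auto intro: square_integrable_integrable\<close>)
  \<comment> \<open>Where the subsequence diverges the value of \<open>lim\<close> is unspecified;
    this concerns only a null set and leaves \<open>v\<close> measurable.\<close>
  define v where "v x = lim (\<lambda>i. u (r i) x)" for x
  have [measurable]: "v \<in> borel_measurable M"
    unfolding v_def by measurable
  have lim: "AE x in M. (\<lambda>i. u (r i) x) \<longlonglongrightarrow> v x"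
    using ae by eventually_elim (auto simp: v_def Cauchy_convergent_iff convergent_LIMSEQ_iff)
  have fatou: "integrable M (\<lambda>x. (cmod (u n x - v x))\<^sup>2) \<and> (LINT x|M. (cmod (u n x - v x))\<^sup>2) \<le> e"
    if N: "\<And>m n. m \<ge> N \<Longrightarrow> n \<ge> N \<Longrightarrow> (LINT x|M. (cmod (u m x - u n x))\<^sup>2) \<le> e"
      and "n \<ge> N" "e > 0" for e n N
  proof -
    have "(\<integral>\<^sup>+x. ennreal ((cmod (u n x - v x))\<^sup>2) \<partial>M)
        = (\<integral>\<^sup>+x. liminf (\<lambda>i. ennreal ((cmod (u n x - u (r i) x))\<^sup>2)) \<partial>M)"
    proof (rule nn_integral_cong_AE)
      show "AE x in M. ennreal ((cmod (u n x - v x))\<^sup>2)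
          = liminf (\<lambda>i. ennreal ((cmod (u n x - u (r i) x))\<^sup>2))"
        using lim
      proof eventually_elim
        case (elim x)
        then have "(\<lambda>i. ennreal ((cmod (u n x - u (r i) x))\<^sup>2)) \<longlonglongrightarrow> ennreal ((cmod (u n x - v x))\<^sup>2)"
          by (intro tendsto_ennrealI tendsto_intros)
        then show ?case
          by (rule lim_imp_Liminf[OF sequentially_bot, symmetric])
      qed
    qed
    also have "\<dots> \<le> liminf (\<lambda>i. \<integral>\<^sup>+x. ennreal ((cmod (u n x - u (r i) x))\<^sup>2) \<partial>M)"
      by (intro nn_integral_liminf) measurable
    also have "\<dots> \<le> liminf (\<lambda>i. ennreal e)"
    proof (rule Liminf_mono)
      show "\<forall>\<^sub>F i in sequentially. (\<integral>\<^sup>+x. ennreal ((cmod (u n x - u (r i) x))\<^sup>2) \<partial>M) \<le> ennreal e"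
      proof (rule eventually_sequentiallyI[of N])
        fix i assume "i \<ge> N"
        then have "r i \<ge> N"
          using seq_suble[OF r, of i] by simp
        have "(\<integral>\<^sup>+x. ennreal ((cmod (u n x - u (r i) x))\<^sup>2) \<partial>M)
            = ennreal (LINT x|M. (cmod (u n x - u (r i) x))\<^sup>2)"
          by (intro nn_integral_eq_integral square_integrableD(2) square_integrable_diff u) auto
        also have "\<dots> \<le> ennreal e"
          using N[OF \<open>n \<ge> N\<close> \<open>r i \<ge> N\<close>] by (rule ennreal_leI)
        finally show "(\<integral>\<^sup>+x. ennreal ((cmod (u n x - u (r i) x))\<^sup>2) \<partial>M) \<le> ennreal e" .
      qed
    qed
    also have "\<dots> = ennreal e"
      by (simp add: Liminf_const)
    finally have le: "(\<integral>\<^sup>+x. ennreal ((cmod (u n x - v x))\<^sup>2) \<partial>M) \<le> ennreal e" .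
    then have int: "integrable M (\<lambda>x. (cmod (u n x - v x))\<^sup>2)"
      by (intro integrableI_bounded) (auto intro: le_less_trans)
    have "ennreal (LINT x|M. (cmod (u n x - v x))\<^sup>2) \<le> ennreal e"
      using le by (subst (asm) nn_integral_eq_integral[OF int]) auto
    then show ?thesis
      using int \<open>e > 0\<close> by (simp add: ennreal_le_iff)
  qed
  obtain N1 where N1: "\<And>m n. m \<ge> N1 \<Longrightarrow> n \<ge> N1 \<Longrightarrow> (LINT x|M. (cmod (u m x - u n x))\<^sup>2) \<le> 1"
    using cauchy[of 1] by auto
  have "(\<lambda>x. u N1 x - v x) \<in> square_integrable M"
    using fatou[OF N1, of N1] by (simp add: square_integrable_def)
  from square_integrable_diff[OF u[of N1] this] have "v \<in> square_integrable M"
    by simp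
  moreover have "(\<lambda>n. LINT x|M. (cmod (u n x - v x))\<^sup>2) \<longlonglongrightarrow> 0"
  proof (rule LIMSEQ_I)
    fix e :: real assume "e > 0"
    then obtain N where N: "\<And>m n. m \<ge> N \<Longrightarrow> n \<ge> N \<Longrightarrow>
        (LINT x|M. (cmod (u m x - u n x))\<^sup>2) \<le> e / 2"
      using cauchy[of "e / 2"] by auto
    have "norm ((LINT x|M. (cmod (u n x - v x))\<^sup>2) - 0) < e" if "n \<ge> N" for n
    proof -
      have "0 \<le> (LINT x|M. (cmod (u n x - v x))\<^sup>2)" by (intro integral_nonneg_AE) auto
      then show ?thesis
        using fatou[OF N that] \<open>e > 0\<close> by simp
    qed
    then show "\<exists>N. \<forall>n\<ge>N. norm ((LINT x|M. (cmod (u n x - v x))\<^sup>2) - 0) < e" by blast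
  qed
  ultimately show thesis by (rule that)
qed

section \<open>Orthogonal projection onto closed subspaces of square-integrable functions\<close>

lemma integral_linear_combination3:
  fixes f g h :: "'a \<Rightarrow> real"
  assumes "integrable M f" "integrable M g" "integrable M h"
  shows "(LINT x|M. a * f x + b * g x + c * h x)
    = a * integral\<^sup>L M f + b * integral\<^sup>L M g + c * integral\<^sup>L M h"
  using assms by simp

text \<open>The parallelogram law for \<open>f - x\<close> and \<open>f - y\<close>, whose mean is
  \<open>f\<close> minus the midpoint of \<open>x\<close> and \<open>y\<close>. The term with
  \<open>- 4\<close> is added so that the right-hand side is a plain linear combination for termwise
  integration.\<close>

lemma cmod_parallelogram:
  "(cmod (x - y))\<^sup>2
    = 2 * (cmod (f - x))\<^sup>2 + 2 * (cmod (f - y))\<^sup>2 + (- 4) * (cmod (f - (1 / 2) * (x + y)))\<^sup>2"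
  unfolding cmod_power2 by (simp add: power2_eq_square field_simps)

text \<open>Hilbert's projection theorem for functions instead of equivalence classes. By the
  parallelogram law a minimising sequence for the distance to \<open>K\<close> is Cauchy; a
  first-order variation at the minimiser gives orthogonality.\<close>

lemma (in finite_measure) square_integrable_orthogonal_projection:
  assumes F: "F \<in> square_integrable M"
    and K: "K \<subseteq> square_integrable M" "K \<noteq> {}"
    and add: "\<And>f g. f \<in> K \<Longrightarrow> g \<in> K \<Longrightarrow> (\<lambda>x. f x + g x) \<in> K"
    and cmult: "\<And>c f. f \<in> K \<Longrightarrow> (\<lambda>x. c * f x) \<in> K"
    and closed: "\<And>u v. (\<And>n. u n \<in> K) \<Longrightarrow> v \<in> square_integrable M \<Longrightarrow>
      (\<lambda>n. LINT x|M. (cmod (u n x - v x))\<^sup>2) \<longlonglongrightarrow> 0 \<Longrightarrow> v \<in> K"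
  shows "\<exists>g\<in>K. \<forall>h\<in>K. (LINT x|M. (F x - g x) * cnj (h x)) = 0"
proof -
  define D where "D g = (LINT x|M. (cmod (F x - g x))\<^sup>2)" for g
  define q where "q = (INF g\<in>K. D g)"
  have D_nonneg: "0 \<le> D g" for g
    unfolding D_def by (intro integral_nonneg_AE) auto
  have bdd: "bdd_below (D ` K)"
    using D_nonneg by (auto intro!: bdd_belowI[of _ 0])
  have q_le: "q \<le> D g" if "g \<in> K" for g
    unfolding q_def using bdd that by (rule cINF_lower)
  have "\<exists>g\<in>K. D g < q + 1 / real (Suc n)" for n
    using cINF_less_iff[OF K(2) bdd, of "q + 1 / real (Suc n)"] by (simp add: q_def)
  then obtain u where uK: "\<And>n. u n \<in> K" and uD: "\<And>n. D (u n) < q + 1 / real (Suc n)"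
    by metis
  have sq: "(\<lambda>x. F x - g x) \<in> square_integrable M" if "g \<in> K" for g
    using that K(1) F by (auto intro: square_integrable_diff)
  have "\<exists>N. \<forall>m\<ge>N. \<forall>n\<ge>N. (LINT x|M. (cmod (u m x - u n x))\<^sup>2) \<le> e" if "e > 0" for e
  proof -
    \<comment> \<open>Both \<open>D (u m)\<close> and \<open>D (u n)\<close> exceed \<open>q\<close>
      by less than \<open>e / 4\<close>, and the midpoint has distance at least \<open>q\<close>;
      the law then leaves \<open>2 * e / 4 + 2 * e / 4 = e\<close>.\<close>
    obtain N where N: "1 / real (Suc N) < e / 4"
      using reals_Archimedean[of "e / 4"] \<open>e > 0\<close> by (auto simp: inverse_eq_divide)
    have "(LINT x|M. (cmod (u m x - u n x))\<^sup>2) \<le> e" if "m \<ge> N" "n \<ge> N" for m n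
    proof -
      let ?w = "\<lambda>x. (1 / 2) * (u m x + u n x)"
      have wK: "?w \<in> K"
        by (intro cmult add uK)
      have small: "1 / real (Suc k) < e / 4" if "k \<ge> N" for k
        using N that frac_le[of 1 1 "real (Suc N)" "real (Suc k)"] by simp
      have "(LINT x|M. (cmod (u m x - u n x))\<^sup>2) = (LINT x|M. 2 * (cmod (F x - u m x))\<^sup>2
          + 2 * (cmod (F x - u n x))\<^sup>2 + (- 4) * (cmod (F x - ?w x))\<^sup>2)"
        by (intro Bochner_Integration.integral_cong cmod_parallelogram refl)
      also have "\<dots> = 2 * D (u m) + 2 * D (u n) + (- 4) * D ?w"
        unfolding D_def
        by (intro integral_linear_combination3 square_integrableD(2)[OF sq] uK wK)
      also have "\<dots> \<le> e"
        using uD[of m] uD[of n] q_le[OF wK] small[OF \<open>m \<ge> N\<close>] small[OF \<open>n \<ge> N\<close>] by linarith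
      finally show ?thesis .
    qed
    then show ?thesis by blast
  qed
  then obtain g where g: "g \<in> square_integrable M"
    and lim: "(\<lambda>n. LINT x|M. (cmod (u n x - g x))\<^sup>2) \<longlonglongrightarrow> 0"
    by (rule square_integrable_complete[OF subsetD[OF K(1) uK]])
  have gK: "g \<in> K"
    using uK g lim by (rule closed)
  have "D g \<le> q"
  proof (rule LIMSEQ_le_const)
    have "(\<lambda>n. 1 / real (Suc n)) \<longlonglongrightarrow> 0"
      by (rule LIMSEQ_Suc[OF lim_1_over_n])
    from tendsto_add[OF tendsto_add[OF tendsto_const[of q] tendsto_mult[OF tendsto_const[of 2] this]]
        tendsto_mult[OF tendsto_const[of 2] lim]]
    show "(\<lambda>n. q + 2 * (1 / real (Suc n)) + 2 * (LINT x|M. (cmod (u n x - g x))\<^sup>2)) \<longlonglongrightarrow> q"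
      by simp
    have "D g \<le> q + 2 * (1 / real (Suc n)) + 2 * (LINT x|M. (cmod (u n x - g x))\<^sup>2)" for n
    proof -
      \<comment> \<open>Reflecting \<open>g\<close> in \<open>u n\<close> stays in \<open>K\<close>, so the parallelogram law bounds \<open>D g\<close> from above.\<close>
      let ?w = "\<lambda>x. 2 * u n x + (-1) * g x"
      have wK: "?w \<in> K"
        by (intro cmult add uK gK)
      have ug: "integrable M (\<lambda>x. (cmod (u n x - g x))\<^sup>2)"
        using uK K(1) g by (intro square_integrableD(2) square_integrable_diff) auto
      have "D g = (LINT x|M. 2 * (cmod (F x - u n x))\<^sup>2 + 2 * (cmod (u n x - g x))\<^sup>2
          + (- 1) * (cmod (F x - ?w x))\<^sup>2)"
        unfolding D_def
        by (intro Bochner_Integration.integral_cong refl)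
          (simp only: cmod_power2; simp add: power2_eq_square algebra_simps)
      also have "\<dots> = 2 * D (u n) + 2 * (LINT x|M. (cmod (u n x - g x))\<^sup>2) + (- 1) * D ?w"
        unfolding D_def
        by (intro integral_linear_combination3 square_integrableD(2)[OF sq] ug uK wK)
      finally show ?thesis
        using uD[of n] q_le[OF wK] by linarith
    qed
    then show "\<exists>N. \<forall>n\<ge>N. D g \<le> q + 2 * (1 / real (Suc n)) + 2 * (LINT x|M. (cmod (u n x - g x))\<^sup>2)"
      by blast
  qed
  have "(LINT x|M. (F x - g x) * cnj (h x)) = 0" if hK: "h \<in> K" for h
  proof -
    define c where "c = (LINT x|M. (F x - g x) * cnj (h x))"
    define B where "B = (LINT x|M. (cmod (h x))\<^sup>2)"
    \<comment> \<open>Moving from \<open>g\<close> by \<open>s * c * h\<close> changes the squared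
      distance by \<open>(cmod c)^2 * (s^2 * B - 2 * s)\<close>, which is negative for
      \<open>s * B < 1\<close> unless \<open>c = 0\<close>. The summand 1 covers
      \<open>B = 0\<close>.\<close>
    define s where "s = 1 / (B + 1)"
    have "B \<ge> 0" unfolding B_def by (intro integral_nonneg_AE) auto
    have h: "integrable M (\<lambda>x. (cmod (h x))\<^sup>2)"
      using hK K(1) by (auto dest: square_integrableD)
    have Fgh: "integrable M (\<lambda>x. (F x - g x) * cnj (h x))"
      using sq[OF gK] hK K(1) by (intro square_integrable_mult_cnj) auto
    have wK: "(\<lambda>x. g x + of_real s * c * h x) \<in> K"
      by (intro add cmult gK hK)
    have "q \<le> D (\<lambda>x. g x + of_real s * c * h x)"
      using wK by (rule q_le)
    also have "\<dots> = (LINT x|M. 1 * (cmod (F x - g x))\<^sup>2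
        + (- 2 * s) * Re (cnj c * ((F x - g x) * cnj (h x))) + s\<^sup>2 * (cmod c)\<^sup>2 * (cmod (h x))\<^sup>2)"
      unfolding D_def
      by (intro Bochner_Integration.integral_cong refl)
        (simp only: cmod_power2; simp add: power2_eq_square algebra_simps)
    also have "\<dots> = 1 * D g + (- 2 * s) * Re (cnj c * c) + s\<^sup>2 * (cmod c)\<^sup>2 * B"
    proof -
      have i: "integrable M (\<lambda>x. cnj c * ((F x - g x) * cnj (h x)))"
        using Fgh by (rule integrable_mult_right)
      have "(LINT x|M. Re (cnj c * ((F x - g x) * cnj (h x)))) = Re (cnj c * c)"
        using integral_Re[OF i] by (simp only: integral_mult_right_zero c_def)
      then show ?thesis
        using integral_linear_combination3[OF square_integrableD(2)[OF sq[OF gK]] integrable_Re[OF i] h,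
            of 1 "- 2 * s" "s\<^sup>2 * (cmod c)\<^sup>2"]
        unfolding D_def B_def by (simp only:)
    qed
    also have "Re (cnj c * c) = (cmod c)\<^sup>2"
      unfolding cmod_power2 by (simp add: power2_eq_square)
    finally have "2 * s * (cmod c)\<^sup>2 \<le> s\<^sup>2 * (cmod c)\<^sup>2 * B"
      using \<open>D g \<le> q\<close> by linarith
    then have "s * ((2 - s * B) * (cmod c)\<^sup>2) \<le> 0"
      by (simp add: power2_eq_square algebra_simps)
    moreover have "s > 0" "s * B < 1"
      using \<open>B \<ge> 0\<close> by (simp_all add: s_def field_simps)
    ultimately have "(cmod c)\<^sup>2 \<le> 0"
      by (simp add: mult_le_0_iff)
    then show ?thesis
      by (simp add: c_def)
  qed
  with gK show ?thesis by blast
qed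

section \<open>The Hardy space and the Riesz projection on the circle\<close>

interpretation arc_length: finite_measure arc_length
  by (rule finite_measureI) (simp add: emeasure_arc_length_space)

lemma circle_Lp_2: "circle_Lp 2 = square_integrable arc_length"
  by (simp add: circle_Lp_def square_integrable_def)

lemma borel_measurable_arc_length_iff:
  "f \<in> borel_measurable arc_length \<longleftrightarrow> f \<in> borel_measurable (restrict_space borel (sphere 0 1))"
  using measurable_cong_sets[OF sets_arc_length refl] by blast

lemma continuous_on_imp_borel_measurable_arc_length:
  "continuous_on (sphere 0 1) f \<Longrightarrow> f \<in> borel_measurable arc_length"
  unfolding borel_measurable_arc_length_iff by (rule borel_measurable_continuous_on_restrict)

lemma continuous_on_circle_bounded:
  fixes f :: "complex \<Rightarrow> complex"
  assumes "continuous_on (sphere 0 1) f"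
  obtains B where "B \<ge> 0" "\<And>z. cmod z = 1 \<Longrightarrow> cmod (f z) \<le> B"
proof -
  have "bounded (f ` sphere 0 1)"
    using assms by (intro compact_imp_bounded compact_continuous_image) auto
  then obtain B where "B > 0" "\<And>x. x \<in> f ` sphere 0 1 \<Longrightarrow> cmod x \<le> B"
    by (auto simp: bounded_pos)
  then show thesis
    by (intro that[of B]) auto
qed

lemma integrable_mult_continuous_on_circle:
  assumes g: "integrable arc_length g" and f: "continuous_on (sphere 0 1) f"
  shows "integrable arc_length (\<lambda>z. g z * f z :: complex)"
proof -
  obtain B where B: "B \<ge> 0" "\<And>z. cmod z = 1 \<Longrightarrow> cmod (f z) \<le> B"
    using continuous_on_circle_bounded[OF f] by blast
  show ?thesis
  proof (rule Bochner_Integration.integrable_bound)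
    show "integrable arc_length (\<lambda>z. of_real B * g z)"
      using g by (rule integrable_mult_right)
    show "AE z in arc_length. norm (g z * f z) \<le> norm (of_real B * g z)"
      using B by (intro AE_I2) (auto simp: space_arc_length norm_mult mult.commute intro: mult_right_mono)
    show "(\<lambda>z. g z * f z) \<in> borel_measurable arc_length"
      using continuous_on_imp_borel_measurable_arc_length[OF f] borel_measurable_integrable[OF g]
      by (intro borel_measurable_times)
  qed
qed

lemma square_integrable_continuous_on_circle:
  assumes f: "continuous_on (sphere 0 1) f"
  shows "f \<in> square_integrable arc_length"
proof -
  obtain B where B: "B \<ge> 0" "\<And>z. cmod z = 1 \<Longrightarrow> cmod (f z) \<le> B"
    using continuous_on_circle_bounded[OF f] by blast
  note [measurable] = continuous_on_imp_borel_measurable_arc_length[OF f]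
  have "integrable arc_length (\<lambda>z. (cmod (f z))\<^sup>2)"
    by (rule arc_length.integrable_const_bound[of _ "B\<^sup>2"])
      (use B in \<open>auto simp: space_arc_length intro!: AE_I2 power_mono\<close>)
  then show ?thesis
    by (simp add: square_integrable_def)
qed

lemma continuous_on_circle_powi: "continuous_on (sphere 0 1) (\<lambda>z::complex. z powi k)"
  by (intro continuous_on_power_int continuous_intros) auto

lemma hardy_2_integrable:
  assumes "f \<in> hardy 2"
  shows "integrable arc_length f" "integrable arc_length (\<lambda>z. f z * z powi k)"
proof -
  show "integrable arc_length f"
    using assms by (intro arc_length.square_integrable_integrable)
      (simp add: hardy_def circle_Lp_2)
  then show "integrable arc_length (\<lambda>z. f z * z powi k)"
    by (rule integrable_mult_continuous_on_circle[OF _ continuous_on_circle_powi])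
qed

text \<open>Negative frequencies become moments against natural powers of \<open>z\<close>, the form
  in which power series can be integrated termwise.\<close>

lemma hardy_2_iff:
  "f \<in> hardy 2 \<longleftrightarrow> f \<in> square_integrable arc_length \<and> (\<forall>n>0. (LINT z|arc_length. f z * z ^ n) = 0)"
proof -
  have "(\<forall>k<0. fourier_coeff f k = 0) \<longleftrightarrow> (\<forall>n>0. (LINT z|arc_length. f z * z ^ n) = 0)"
  proof safe
    fix n :: nat assume "\<forall>k<0. fourier_coeff f k = 0" "n > 0"
    then have "fourier_coeff f (- int n) = 0" by simp
    then show "(LINT z|arc_length. f z * z ^ n) = 0"
      by (simp add: fourier_coeff_def)
  next
    fix k :: int assume *: "\<forall>n>0. (LINT z|arc_length. f z * z ^ n) = 0" "k < 0"
    then have "(LINT z|arc_length. f z * z ^ nat (- k)) = 0" by simp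
    then show "fourier_coeff f k = 0"
      using \<open>k < 0\<close> by (simp add: fourier_coeff_def power_int_def)
  qed
  then show ?thesis
    by (simp add: hardy_def circle_Lp_2)
qed

text \<open>Each moment against \<open>z ^ k\<close> is continuous in mean square, because
  \<open>cmod (z ^ k) = 1\<close> on the circle and Cauchy-Schwarz applies to
  \<open>u n - v\<close>.\<close>

lemma hardy_2_closed:
  assumes u: "\<And>n. u n \<in> hardy 2" and v: "v \<in> square_integrable arc_length"
    and lim: "(\<lambda>n. LINT z|arc_length. (cmod (u n z - v z))\<^sup>2) \<longlonglongrightarrow> 0"
  shows "v \<in> hardy 2"
proof -
  have "(LINT z|arc_length. v z * z ^ k) = 0" if "k > 0" for k
  proof -
    have v1: "integrable arc_length v"
      using v by (rule arc_length.square_integrable_integrable)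
    have cont: "continuous_on (sphere 0 1) (\<lambda>z::complex. z ^ k)"
      by (intro continuous_intros)
    have bound: "(cmod (LINT z|arc_length. v z * z ^ k))\<^sup>2
        \<le> (LINT z|arc_length. (cmod (u n z - v z))\<^sup>2) * measure arc_length (space arc_length)" for n
    proof -
      have un: "u n \<in> square_integrable arc_length"
        using u[of n] by (simp add: hardy_2_iff)
      have un1: "integrable arc_length (u n)"
        by (rule hardy_2_integrable(1)[OF u])
      have "(LINT z|arc_length. (u n z - v z) * z ^ k)
          = (LINT z|arc_length. u n z * z ^ k) - (LINT z|arc_length. v z * z ^ k)"
        unfolding left_diff_distrib
        by (intro Bochner_Integration.integral_diff integrable_mult_continuous_on_circle un1 v1 cont)
      also have "(LINT z|arc_length. u n z * z ^ k) = 0"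
        using u[of n] \<open>k > 0\<close> by (simp add: hardy_2_iff)
      finally have "cmod (LINT z|arc_length. v z * z ^ k)
          = cmod (LINT z|arc_length. (u n z - v z) * z ^ k)"
        by simp
      also have "\<dots> \<le> (LINT z|arc_length. cmod ((u n z - v z) * z ^ k))"
        by (rule integral_norm_bound)
      also have "\<dots> = (LINT z|arc_length. cmod (u n z - v z))"
        by (intro Bochner_Integration.integral_cong refl) (simp add: space_arc_length norm_mult norm_power)
      finally have "(cmod (LINT z|arc_length. v z * z ^ k))\<^sup>2 \<le> (LINT z|arc_length. cmod (u n z - v z))\<^sup>2"
        by (intro power_mono) auto
      also have "\<dots> \<le> (LINT z|arc_length. (cmod (u n z - v z))\<^sup>2) * measure arc_length (space arc_length)"
        by (intro arc_length.integral_cmod_power2_le square_integrable_diff un v)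
      finally show ?thesis .
    qed
    have "(cmod (LINT z|arc_length. v z * z ^ k))\<^sup>2 \<le> 0 * measure arc_length (space arc_length)"
      by (rule LIMSEQ_le_const[OF tendsto_mult_right[OF lim]]) (use bound in blast)
    then show ?thesis by simp
  qed
  with v show ?thesis by (simp add: hardy_2_iff)
qed

lemma riesz_projection_props:
  assumes "F \<in> square_integrable arc_length"
  shows "riesz_projection F \<in> hardy 2"
    and "h \<in> hardy 2 \<Longrightarrow> (LINT z|arc_length. (F z - riesz_projection F z) * cnj (h z)) = 0"
proof -
  have "\<exists>g\<in>hardy 2. \<forall>h\<in>hardy 2. (LINT z|arc_length. (F z - g z) * cnj (h z)) = 0"
  proof (rule arc_length.square_integrable_orthogonal_projection[OF assms])
    show "hardy 2 \<subseteq> square_integrable arc_length"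
      by (auto simp: hardy_2_iff)
    have "(\<lambda>z. 0) \<in> hardy 2"
      by (auto simp: hardy_2_iff square_integrable_def)
    then show "hardy 2 \<noteq> {}" by blast
    show "(\<lambda>x. f x + g x) \<in> hardy 2" if "f \<in> hardy 2" "g \<in> hardy 2" for f g
    proof -
      have "(LINT z|arc_length. (f z + g z) * z ^ n)
          = (LINT z|arc_length. f z * z ^ n) + (LINT z|arc_length. g z * z ^ n)" for n
        unfolding distrib_right
        using hardy_2_integrable(2)[OF that(1), of "int n"] hardy_2_integrable(2)[OF that(2), of "int n"]
        by (intro Bochner_Integration.integral_add) (simp_all add: power_int_of_nat)
      then show ?thesis
        using that by (simp add: hardy_2_iff square_integrable_add)
    qed
    show "(\<lambda>x. c * f x) \<in> hardy 2" if "f \<in> hardy 2" for c f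
      using that by (simp add: hardy_2_iff square_integrable_cmult mult.assoc)
    show "v \<in> hardy 2" if "\<And>n. u n \<in> hardy 2" "v \<in> square_integrable arc_length"
      "(\<lambda>n. LINT x|arc_length. (cmod (u n x - v x))\<^sup>2) \<longlonglongrightarrow> 0" for u v
      using that by (rule hardy_2_closed)
  qed
  then have "\<exists>g. g \<in> hardy 2 \<and> (\<forall>h\<in>hardy 2. (LINT z|arc_length. (F z - g z) * cnj (h z)) = 0)"
    by blast
  from someI_ex[OF this] show "riesz_projection F \<in> hardy 2"
    and "h \<in> hardy 2 \<Longrightarrow> (LINT z|arc_length. (F z - riesz_projection F z) * cnj (h z)) = 0"
    unfolding riesz_projection_def by blast+
qed

section \<open>Arc length in rotated and rescaled coordinates\<close>

lemma measurable_rotated_cis: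
  assumes "cmod t = 1"
  shows "(\<lambda>\<theta>. t * cis \<theta>) \<in> borel \<rightarrow>\<^sub>M restrict_space borel (sphere 0 1)"
  using assms
  by (intro measurable_restrict_space2 borel_measurable_continuous_onI continuous_intros)
    (auto simp: norm_mult)

text \<open>Rotation invariance, with the parameter interval centred so that \<open>t\<close>
  corresponds to the interior point 0 and both of its sides are visible at once.\<close>

lemma arc_length_eq_distr_rotated:
  assumes t: "cmod t = 1"
  shows "arc_length = distr (restrict_space lborel {-pi..<pi}) (restrict_space borel (sphere 0 1))
    (\<lambda>\<theta>. t * cis \<theta>)" (is "_ = ?R")
proof (rule measure_eqI)
  show "sets arc_length = sets ?R"
    by (simp add: sets_arc_length)
  fix A assume A: "A \<in> sets arc_length"
  then have A': "A \<in> sets (restrict_space borel (sphere 0 1))"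
    by (simp add: sets_arc_length)
  \<comment> \<open>The left endpoint \<open>- pi\<close> is mapped to \<open>- t = cis b\<close>,
    so the rotated interval is \<open>{b..<b+2*pi}\<close>. Its part beyond \<open>2 * pi\<close> is
    folded back to \<open>{0..<b}\<close> by periodicity.\<close>
  define b where "b = Arg2pi (- t)"
  have b: "0 \<le> b" "b < 2 * pi"
    using Arg2pi[of "- t"] by (auto simp: b_def)
  have "cis b = - t"
    using complex_norm_eq_1_exp[of "- t"] t by (simp add: b_def cis_conv_exp)
  then have t_cis: "t * cis \<theta> = cis (b + pi + \<theta>)" for \<theta>
    by (simp add: cis_mult[symmetric])
  define G :: "real \<Rightarrow> ennreal" where "G \<theta> = indicator A (cis \<theta>)" for \<theta>
  have cis_meas: "cis \<in> borel \<rightarrow>\<^sub>M restrict_space borel (sphere 0 1)"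
    using measurable_rotated_cis[of 1] by simp
  have [measurable]: "G \<in> borel_measurable borel"
    unfolding G_def by (rule measurable_compose[OF cis_meas borel_measurable_indicator[OF A']])
  have G_per: "G (2 * pi + 1 * x) = G x" for x
    by (simp add: G_def cis_mult[symmetric])
  have emeas: "emeasure (distr (restrict_space lborel I) (restrict_space borel (sphere 0 1)) k) A
      = (\<integral>\<^sup>+\<theta>. indicator I \<theta> * indicator A (k \<theta>) \<partial>lborel)"
    if I: "I \<in> sets borel" and k: "k \<in> borel \<rightarrow>\<^sub>M restrict_space borel (sphere 0 1)"
    for I :: "real set" and k
  proof -
    have k': "k \<in> restrict_space lborel I \<rightarrow>\<^sub>M restrict_space borel (sphere 0 1)"
      using k by (intro measurable_restrict_space1) simp
    have "emeasure (distr (restrict_space lborel I) (restrict_space borel (sphere 0 1)) k) A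
        = (\<integral>\<^sup>+z. indicator A z \<partial>distr (restrict_space lborel I) (restrict_space borel (sphere 0 1)) k)"
      using A' by simp
    also have "\<dots> = (\<integral>\<^sup>+\<theta>. indicator A (k \<theta>) \<partial>restrict_space lborel I)"
      using A' k' by (intro nn_integral_distr) auto
    also have "\<dots> = (\<integral>\<^sup>+\<theta>. indicator A (k \<theta>) * indicator I \<theta> \<partial>lborel)"
      using I by (subst nn_integral_restrict_space) auto
    finally show ?thesis by (simp only: mult.commute)
  qed
  have "emeasure ?R A = (\<integral>\<^sup>+\<theta>. indicator {-pi..<pi} \<theta> * G (b + pi + \<theta>) \<partial>lborel)"
    unfolding G_def by (subst emeas[OF _ measurable_rotated_cis[OF t]]) (simp_all add: t_cis)
  also have "\<dots> = (\<integral>\<^sup>+\<theta>. indicator {b..<b+2*pi} (b + pi + 1 * \<theta>) * G (b + pi + 1 * \<theta>) \<partial>lborel)"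
    by (intro nn_integral_cong) (auto simp: indicator_def)
  also have "\<dots> = (\<integral>\<^sup>+\<theta>. indicator {b..<b+2*pi} \<theta> * G \<theta> \<partial>lborel)"
    by (subst nn_integral_real_affine[of "\<lambda>\<theta>. indicator {b..<b+2*pi} \<theta> * G \<theta>" 1 "b + pi"]) simp_all
  also have "\<dots> = (\<integral>\<^sup>+\<theta>. indicator {b..<2*pi} \<theta> * G \<theta> + indicator {2*pi..<b+2*pi} \<theta> * G \<theta> \<partial>lborel)"
    using b by (intro nn_integral_cong) (auto simp: indicator_def)
  also have "\<dots> = (\<integral>\<^sup>+\<theta>. indicator {b..<2*pi} \<theta> * G \<theta> \<partial>lborel)
      + (\<integral>\<^sup>+\<theta>. indicator {2*pi..<b+2*pi} \<theta> * G \<theta> \<partial>lborel)"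
    by (intro nn_integral_add) measurable
  also have "(\<integral>\<^sup>+\<theta>. indicator {2*pi..<b+2*pi} \<theta> * G \<theta> \<partial>lborel)
      = (\<integral>\<^sup>+\<theta>. indicator {2*pi..<b+2*pi} (2 * pi + 1 * \<theta>) * G (2 * pi + 1 * \<theta>) \<partial>lborel)"
    by (subst nn_integral_real_affine[of "\<lambda>\<theta>. indicator {2*pi..<b+2*pi} \<theta> * G \<theta>" 1 "2 * pi"]) simp_all
  also have "\<dots> = (\<integral>\<^sup>+\<theta>. indicator {0..<b} \<theta> * G \<theta> \<partial>lborel)"
    unfolding G_per by (intro nn_integral_cong) (auto simp: indicator_def)
  also have "(\<integral>\<^sup>+\<theta>. indicator {b..<2*pi} \<theta> * G \<theta> \<partial>lborel) + \<dots>
      = (\<integral>\<^sup>+\<theta>. indicator {b..<2*pi} \<theta> * G \<theta> + indicator {0..<b} \<theta> * G \<theta> \<partial>lborel)"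
    by (intro nn_integral_add[symmetric]) measurable
  also have "\<dots> = (\<integral>\<^sup>+\<theta>. indicator {0..<2*pi} \<theta> * G \<theta> \<partial>lborel)"
    using b by (intro nn_integral_cong) (auto simp: indicator_def)
  also have "\<dots> = emeasure arc_length A"
    unfolding G_def arc_length_def by (subst emeas[OF _ cis_meas]) simp_all
  finally show "emeasure arc_length A = emeasure ?R A" by simp
qed

lemma borel_measurable_rotated_cis:
  assumes "F \<in> borel_measurable arc_length" "cmod t = 1"
  shows "(\<lambda>\<theta>. F (t * cis \<theta>)) \<in> borel_measurable borel"
  using assms measurable_compose[OF measurable_rotated_cis]
  by (auto simp: borel_measurable_arc_length_iff)

text \<open>The substitution \<open>\<theta> = \<epsilon> * x\<close> magnifies the circle at
  \<open>t\<close>. The indicator keeps the domain equal to the whole line for every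
  \<open>\<epsilon>\<close>, as dominated convergence requires.\<close>

lemma integral_arc_length_rescaled:
  fixes F :: "complex \<Rightarrow> 'b::{banach, second_countable_topology}"
  assumes F: "F \<in> borel_measurable arc_length" and t: "cmod t = 1" and "\<epsilon> > 0"
  shows "(LINT z|arc_length. F z)
    = \<epsilon> *\<^sub>R (LINT x|lborel. indicator {-pi..<pi} (\<epsilon> * x) *\<^sub>R F (t * cis (\<epsilon> * x)))"
proof -
  have m: "(\<lambda>\<theta>. t * cis \<theta>) \<in> restrict_space lborel {-pi..<pi} \<rightarrow>\<^sub>M restrict_space borel (sphere 0 1)"
    using measurable_rotated_cis[OF t] by (intro measurable_restrict_space1) simp
  have "(LINT z|arc_length. F z) = (LINT \<theta>|restrict_space lborel {-pi..<pi}. F (t * cis \<theta>))"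
    using F by (subst arc_length_eq_distr_rotated[OF t])
      (intro integral_distr m; simp add: borel_measurable_arc_length_iff)
  also have "\<dots> = (LINT \<theta>|lborel. indicator {-pi..<pi} \<theta> *\<^sub>R F (t * cis \<theta>))"
    by (subst integral_restrict_space) auto
  also have "\<dots> = \<epsilon> *\<^sub>R (LINT x|lborel. indicator {-pi..<pi} (\<epsilon> * x) *\<^sub>R F (t * cis (\<epsilon> * x)))"
    using \<open>\<epsilon> > 0\<close> by (subst lborel_integral_real_affine[of \<epsilon> _ 0]) auto
  finally show ?thesis .
qed

lemma AE_arc_length_rotated:
  assumes "AE z in arc_length. P z" and t: "cmod t = 1"
  shows "AE \<theta> in lborel. \<theta> \<in> {-pi..<pi} \<longrightarrow> P (t * cis \<theta>)"
proof -
  have m: "(\<lambda>\<theta>. t * cis \<theta>) \<in> restrict_space lborel {-pi..<pi} \<rightarrow>\<^sub>M restrict_space borel (sphere 0 1)"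
    using measurable_rotated_cis[OF t] by (intro measurable_restrict_space1) simp
  have "AE \<theta> in restrict_space lborel {-pi..<pi}. P (t * cis \<theta>)"
    using assms(1) unfolding arc_length_eq_distr_rotated[OF t] by (rule AE_distrD[OF m])
  then show ?thesis
    by (subst (asm) AE_restrict_space_iff) auto
qed

section \<open>Power series on the circle and their moments\<close>

lemma integral_power_arc_length:
  assumes "n > 0"
  shows "(LINT z|arc_length. z ^ n) = (0 :: complex)"
proof -
  \<comment> \<open>Rotation by this \<open>t\<close> preserves the integral by invariance but
    multiplies \<open>z ^ n\<close> by \<open>t ^ n = -1\<close>, so the integral equals its own
    negative.\<close>
  define t where "t = cis (pi / real n)"
  have meas: "(\<lambda>z::complex. z ^ n) \<in> borel_measurable arc_length"
    by (intro continuous_on_imp_borel_measurable_arc_length continuous_intros)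
  have "t ^ n = cis (real n * (pi / real n))"
    unfolding t_def by (rule Complex.DeMoivre)
  also have "real n * (pi / real n) = pi"
    using assms by simp
  finally have "t ^ n = -1" by simp
  have "(LINT z|arc_length. z ^ n) = (LINT x|lborel. indicator {-pi..<pi} (1 * x) *\<^sub>R (t * cis (1 * x)) ^ n)"
    by (subst integral_arc_length_rescaled[OF meas, of t 1]) (simp_all add: t_def)
  also have "\<dots> = (LINT x|lborel. - (indicator {-pi..<pi} (1 * x) *\<^sub>R (1 * cis (1 * x)) ^ n))"
    by (simp add: power_mult_distrib \<open>t ^ n = -1\<close>)
  also have "\<dots> = - (LINT z|arc_length. z ^ n)"
    by (subst integral_arc_length_rescaled[OF meas, of 1 1]) simp_all
  finally show ?thesis by simp
qed

text \<open>Since \<open>cmod z = 1\<close>, the terms are dominated by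
  \<open>cmod (c n) * cmod (g z)\<close>, and absolute summability of the coefficients permits
  termwise integration.\<close>

lemma integral_mult_power_series_circle:
  assumes g: "integrable arc_length g" and c: "summable (\<lambda>n. cmod (c n))"
    and u: "\<And>z. cmod z = 1 \<Longrightarrow> (\<lambda>n. c n * z ^ n) sums u z"
  shows "(\<lambda>n. c n * (LINT z|arc_length. g z * z ^ n)) sums (LINT z|arc_length. g z * u z)"
proof -
  have int: "integrable arc_length (\<lambda>z. g z * z ^ n)" for n
    by (intro integrable_mult_continuous_on_circle g continuous_intros)
  have "(\<lambda>n. LINT z|arc_length. c n * (g z * z ^ n)) sums (LINT z|arc_length. (\<Sum>n. c n * (g z * z ^ n)))"
  proof (rule sums_integral)
    show "integrable arc_length (\<lambda>z. c n * (g z * z ^ n))" for n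
      using int by (rule integrable_mult_right)
    show "AE z in arc_length. summable (\<lambda>n. norm (c n * (g z * z ^ n)))"
      using summable_mult2[OF c]
      by (intro AE_I2) (simp add: space_arc_length norm_mult norm_power)
    have "(LINT z|arc_length. norm (c n * (g z * z ^ n))) = cmod (c n) * (LINT z|arc_length. cmod (g z))" for n
    proof -
      have "(LINT z|arc_length. norm (c n * (g z * z ^ n))) = (LINT z|arc_length. cmod (c n) * cmod (g z))"
        by (intro Bochner_Integration.integral_cong) (auto simp: space_arc_length norm_mult norm_power)
      then show ?thesis by simp
    qed
    then show "summable (\<lambda>n. LINT z|arc_length. norm (c n * (g z * z ^ n)))"
      using summable_mult2[OF c] by simp
  qed
  moreover have "(LINT z|arc_length. (\<Sum>n. c n * (g z * z ^ n))) = (LINT z|arc_length. g z * u z)"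
  proof (intro Bochner_Integration.integral_cong refl)
    fix z assume "z \<in> space arc_length"
    then have "(\<lambda>n. g z * (c n * z ^ n)) sums (g z * u z)"
      by (intro sums_mult u) (simp add: space_arc_length)
    then show "(\<Sum>n. c n * (g z * z ^ n)) = g z * u z"
      by (simp add: sums_iff mult.left_commute)
  qed
  ultimately show ?thesis by simp
qed

lemma hardy_2_power_series:
  assumes cont: "continuous_on (sphere 0 1) u" and c: "summable (\<lambda>n. cmod (c n))"
    and u: "\<And>z. cmod z = 1 \<Longrightarrow> (\<lambda>n. c n * z ^ n) sums u z"
  shows "u \<in> hardy 2"
proof -
  have "(LINT z|arc_length. u z * z ^ k) = 0" if "k > 0" for k
  proof -
    have "integrable arc_length (\<lambda>z. 1 * z ^ k :: complex)"
      by (intro integrable_mult_continuous_on_circle continuous_intros) simp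
    then have "(\<lambda>n. c n * (LINT z|arc_length. 1 * z ^ k * z ^ n)) sums (LINT z|arc_length. 1 * z ^ k * u z)"
      using c u by (rule integral_mult_power_series_circle)
    moreover have "(LINT z|arc_length. 1 * z ^ k * z ^ n) = (0::complex)" for n
      using integral_power_arc_length[of "k + n"] that by (simp add: power_add)
    ultimately have "(\<lambda>n. 0) sums (LINT z|arc_length. u z * z ^ k)"
      by (simp add: mult.commute)
    then show ?thesis
      using sums_unique2[OF sums_zero] by simp
  qed
  then show ?thesis
    using cont by (simp add: hardy_2_iff square_integrable_continuous_on_circle)
qed

text \<open>All moments of \<open>g\<close> of positive order vanish, while its mean is free; this
  is why the constant coefficient has to be zero.\<close>

lemma hardy_2_mult_power_series_integral:
  assumes g: "g \<in> hardy 2" and c: "summable (\<lambda>n. cmod (c n))" "c 0 = 0"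
    and u: "\<And>z. cmod z = 1 \<Longrightarrow> (\<lambda>n. c n * z ^ n) sums u z"
  shows "(LINT z|arc_length. g z * u z) = 0"
proof -
  have "(\<lambda>n. c n * (LINT z|arc_length. g z * z ^ n)) sums (LINT z|arc_length. g z * u z)"
    using hardy_2_integrable(1)[OF g] c(1) u by (rule integral_mult_power_series_circle)
  moreover have "c n * (LINT z|arc_length. g z * z ^ n) = 0" for n
    using g c(2) by (cases "n = 0") (auto simp: hardy_2_iff)
  ultimately show ?thesis
    using sums_unique2[OF sums_zero] by simp
qed

section \<open>Pairing with the logarithm\<close>

lemma circle_LinftyD:
  assumes "a \<in> circle_Linfty"
  shows "a \<in> borel_measurable arc_length" "\<exists>M\<ge>0. AE z in arc_length. cmod (a z) \<le> M"
proof -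
  show "a \<in> borel_measurable arc_length"
    using assms by (simp add: circle_Linfty_def)
  have "esssup arc_length (\<lambda>z. ereal (cmod (a z))) < \<infinity>"
    using assms by (simp add: circle_Linfty_def)
  then obtain M where M: "esssup arc_length (\<lambda>z. ereal (cmod (a z))) \<le> ereal M"
    by (cases "esssup arc_length (\<lambda>z. ereal (cmod (a z)))") auto
  have "AE z in arc_length. ereal (cmod (a z)) \<le> esssup arc_length (\<lambda>z. ereal (cmod (a z)))"
    by (rule esssup_AE)
  then have "AE z in arc_length. cmod (a z) \<le> max M 0"
  proof eventually_elim
    case (elim z)
    then have "ereal (cmod (a z)) \<le> ereal M"
      using M by (rule order_trans)
    then show ?case by simp
  qed
  then show "\<exists>M\<ge>0. AE z in arc_length. cmod (a z) \<le> M"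
    by (intro exI[of _ "max M 0"]) simp
qed

lemma square_integrable_Linfty_mult_continuous:
  assumes a: "a \<in> circle_Linfty" and f: "continuous_on (sphere 0 1) f"
  shows "(\<lambda>z. a z * f z) \<in> square_integrable arc_length"
proof -
  obtain M where M: "M \<ge> 0" "AE z in arc_length. cmod (a z) \<le> M"
    using circle_LinftyD(2)[OF a] by blast
  obtain B where B: "B \<ge> 0" "\<And>z. cmod z = 1 \<Longrightarrow> cmod (f z) \<le> B"
    using continuous_on_circle_bounded[OF f] by blast
  note [measurable] = circle_LinftyD(1)[OF a] continuous_on_imp_borel_measurable_arc_length[OF f]
  have "integrable arc_length (\<lambda>z. (cmod (a z * f z))\<^sup>2)"
  proof (rule arc_length.integrable_const_bound)
    show "AE z in arc_length. norm ((cmod (a z * f z))\<^sup>2) \<le> (M * B)\<^sup>2"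
      using M(2) AE_space[of arc_length]
    proof eventually_elim
      case (elim z)
      then have "cmod (a z) * cmod (f z) \<le> M * B"
        using M B by (intro mult_mono) (auto simp: space_arc_length)
      then show ?case
        by (simp add: norm_mult power_mono)
    qed
  qed measurable
  then show ?thesis
    by (simp add: square_integrable_def)
qed

lemma circle_Lp_norm_1: "circle_Lp_norm 1 f = (LINT z|arc_length. cmod (f z))"
  by (simp add: circle_Lp_norm_def integral_nonneg_AE)

text \<open>The values \<open>1 - q * z\<close> lie in the open right half-plane, away from the
  branch cut of \<open>Ln\<close>.\<close>

lemma one_minus_mult_circle:
  assumes "cmod q < 1" "cmod z = 1"
  shows "Re (1 - q * z) > 0" "1 - q * z \<notin> \<real>\<^sub>\<le>\<^sub>0" "1 - q * z \<noteq> 0" "cmod (q * z) < 1"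
proof -
  show *: "cmod (q * z) < 1"
    using assms by (simp add: norm_mult)
  then show **: "Re (1 - q * z) > 0"
    using complex_Re_le_cmod[of "q * z"] by simp
  then show "1 - q * z \<notin> \<real>\<^sub>\<le>\<^sub>0"
    by (auto simp: complex_nonpos_Reals_iff)
  then show "1 - q * z \<noteq> 0" by auto
qed

lemma hardy_2_inverse_square:
  assumes "cmod q < 1"
  shows "continuous_on (sphere 0 1) (\<lambda>z. k / (1 - q * z)\<^sup>2)" "(\<lambda>z. k / (1 - q * z)\<^sup>2) \<in> hardy 2"
proof -
  show cont: "continuous_on (sphere 0 1) (\<lambda>z. k / (1 - q * z)\<^sup>2)"
    using one_minus_mult_circle(3)[OF assms] by (intro continuous_intros) auto
  have "(\<lambda>n. of_nat (Suc n) * cmod q ^ n) sums (1 / (1 - cmod q)\<^sup>2)"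
    using assms by (intro geometric_deriv_sums) simp
  from summable_mult[OF sums_summable[OF this], of "cmod k"]
  have summ: "summable (\<lambda>n. cmod (k * (of_nat (Suc n) * q ^ n)))"
    by (simp add: norm_mult norm_power del: of_nat_Suc)
  show "(\<lambda>z. k / (1 - q * z)\<^sup>2) \<in> hardy 2"
  proof (rule hardy_2_power_series[OF cont summ])
    fix z :: complex assume "cmod z = 1"
    from sums_mult[OF geometric_deriv_sums[OF one_minus_mult_circle(4)[OF assms this]], of k]
    show "(\<lambda>n. k * (of_nat (Suc n) * q ^ n) * z ^ n) sums (k / (1 - q * z)\<^sup>2)"
      by (simp add: power_mult_distrib mult.assoc)
  qed
qed

text \<open>The coefficient at \<open>n = 0\<close> is a division by zero and hence 0, which is the
  correct constant term because \<open>Ln 1 = 0\<close>.\<close>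

lemma Ln_one_minus_power_series:
  assumes "cmod q < 1"
  shows "continuous_on (sphere 0 1) (\<lambda>z. Ln (1 - q * z))"
    "summable (\<lambda>n. cmod (- (q ^ n) / of_nat n))"
    "cmod z = 1 \<Longrightarrow> (\<lambda>n. - (q ^ n) / of_nat n * z ^ n) sums Ln (1 - q * z)"
proof -
  show "continuous_on (sphere 0 1) (\<lambda>z. Ln (1 - q * z))"
    using one_minus_mult_circle(2)[OF assms] by (intro continuous_intros) auto
  have geo: "summable (\<lambda>n. cmod q ^ n)"
    using assms by (intro summable_geometric) simp
  show "summable (\<lambda>n. cmod (- (q ^ n) / of_nat n))"
  proof (rule summable_comparison_test'[OF geo, of 0])
    fix n :: nat
    show "norm (cmod (- (q ^ n) / of_nat n)) \<le> cmod q ^ n"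
      by (cases "n = 0") (auto simp: norm_divide norm_power divide_le_eq mult_le_cancel_left1)
  qed
  show "(\<lambda>n. - (q ^ n) / of_nat n * z ^ n) sums Ln (1 - q * z)" if "cmod z = 1"
    using Ln_series'[of "- (q * z)"] one_minus_mult_circle(4)[OF assms that]
    by (simp add: power_mult_distrib)
qed

text \<open>The projection \<open>g\<close> of \<open>a f\<close> has the same pairing with
  \<open>H\<close> as \<open>a f\<close>, and \<open>g * H\<close> has mean zero. So
  \<open>cnj H\<close> may be replaced by \<open>cnj H - H = - 2 * \<i> * Im H\<close>, of modulus
  at most \<open>2 * pi\<close>, and only the \<open>L^1\<close> norm of \<open>g\<close>
  remains.\<close>

lemma toeplitz_pairing_bound:
  assumes a: "a \<in> circle_Linfty"
    and C: "\<And>f. f \<in> hardy 2 \<Longrightarrow> circle_Lp_norm 1 (toeplitz a f) \<le> C * circle_Lp_norm 1 f"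
    and q: "cmod q < 1" and f: "f \<in> hardy 2" "continuous_on (sphere 0 1) f"
  shows "cmod (LINT z|arc_length. a z * f z * cnj (Ln (1 - q * z)))
    \<le> 2 * pi * (C * (LINT z|arc_length. cmod (f z)))"
proof -
  define F where "F z = a z * f z" for z
  define H where "H z = Ln (1 - q * z)" for z
  define g where "g = riesz_projection F"
  have F: "F \<in> square_integrable arc_length"
    unfolding F_def by (rule square_integrable_Linfty_mult_continuous[OF a f(2)])
  have H: "H \<in> hardy 2"
    unfolding H_def by (rule hardy_2_power_series[OF Ln_one_minus_power_series[OF q]])
  have g: "g \<in> hardy 2"
    unfolding g_def by (rule riesz_projection_props(1)[OF F])
  have sq: "H \<in> square_integrable arc_length" "g \<in> square_integrable arc_length"
    using H g by (simp_all add: hardy_2_iff)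
  have gH: "integrable arc_length (\<lambda>z. g z * H z)"
    unfolding H_def using hardy_2_integrable(1)[OF g] Ln_one_minus_power_series(1)[OF q]
    by (rule integrable_mult_continuous_on_circle)
  have "(LINT z|arc_length. (F z - g z) * cnj (H z)) = 0"
    unfolding g_def by (rule riesz_projection_props(2)[OF F H])
  then have "(LINT z|arc_length. F z * cnj (H z)) = (LINT z|arc_length. g z * cnj (H z))"
    unfolding left_diff_distrib
    by (subst (asm) Bochner_Integration.integral_diff)
      (auto intro!: square_integrable_mult_cnj F sq)
  also have "(LINT z|arc_length. g z * H z) = 0"
    unfolding H_def
    by (rule hardy_2_mult_power_series_integral[OF g Ln_one_minus_power_series(2)[OF q] _
          Ln_one_minus_power_series(3)[OF q]]) simp_all
  then have "(LINT z|arc_length. g z * cnj (H z))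
      = (LINT z|arc_length. g z * cnj (H z)) - (LINT z|arc_length. g z * H z)"
    by simp
  also have "\<dots> = (LINT z|arc_length. g z * (cnj (H z) - H z))"
    unfolding right_diff_distrib
    by (intro Bochner_Integration.integral_diff[symmetric] square_integrable_mult_cnj sq gH)
  finally have "cmod (LINT z|arc_length. F z * cnj (H z)) \<le> (LINT z|arc_length. cmod (g z * (cnj (H z) - H z)))"
    by simp
  also have "\<dots> \<le> (LINT z|arc_length. 2 * pi * cmod (g z))"
  proof (rule integral_mono)
    show "integrable arc_length (\<lambda>z. cmod (g z * (cnj (H z) - H z)))"
      unfolding right_diff_distrib
      by (intro integrable_norm Bochner_Integration.integrable_diff square_integrable_mult_cnj sq gH)
    show "integrable arc_length (\<lambda>z. 2 * pi * cmod (g z))"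
      using hardy_2_integrable(1)[OF g] by simp
    fix z assume "z \<in> space arc_length"
    then have "1 - q * z \<noteq> 0"
      using one_minus_mult_circle(3)[OF q] by (simp add: space_arc_length)
    then have "\<bar>Im (H z)\<bar> \<le> pi"
      using mpi_less_Im_Ln[of "1 - q * z"] Im_Ln_le_pi[of "1 - q * z"] by (simp add: H_def)
    moreover have "cnj (H z) - H z = - (2 * \<i> * of_real (Im (H z)))"
      by (simp add: complex_eq_iff)
    ultimately have "cmod (cnj (H z) - H z) \<le> 2 * pi"
      by (simp add: norm_mult)
    then show "cmod (g z * (cnj (H z) - H z)) \<le> 2 * pi * cmod (g z)"
      by (simp add: norm_mult mult.commute mult_left_mono)
  qed
  also have "\<dots> = 2 * pi * circle_Lp_norm 1 (toeplitz a f)"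
    by (simp add: circle_Lp_norm_1 toeplitz_def g_def F_def[abs_def])
  also have "\<dots> \<le> 2 * pi * (C * circle_Lp_norm 1 f)"
    using C[OF f(1)] by simp
  finally show ?thesis
    by (simp add: F_def H_def circle_Lp_norm_1)
qed

section \<open>Uniform bounds and limits for \<open>1 - (1 - \<epsilon>) z\<close> and its
  logarithm\<close>

lemma sin_ge_quarter:
  assumes "0 \<le> y" "y \<le> pi / 2"
  shows "y / 4 \<le> sin (y::real)"
\<comment> \<open>Up to \<open>pi / 3\<close> the cosine is at least 1/2, so
  \<open>y / 2 - sin y\<close> decreases from 0. Beyond it the sine exceeds
  \<open>sin (pi / 6) = 1 / 2\<close>, while \<open>y / 4 \<le> pi / 8 < 1 / 2\<close>.\<close>
proof (cases "y \<le> pi / 3")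
  case True
  have "0 / 2 - sin 0 \<ge> y / 2 - sin y"
  proof (rule DERIV_nonpos_imp_nonincreasing[OF assms(1)])
    fix x assume x: "0 \<le> x" "x \<le> y"
    have "cos (pi / 3) \<le> cos x"
      using x True by (intro cos_monotone_0_pi_le) auto
    then have "1 / 2 - cos x \<le> 0"
      by (simp add: cos_60)
    moreover have "((\<lambda>y. y / 2 - sin y) has_real_derivative 1 / 2 - cos x) (at x)"
      by (auto intro!: derivative_eq_intros)
    ultimately show "\<exists>D. ((\<lambda>y. y / 2 - sin y) has_real_derivative D) (at x) \<and> D \<le> 0"
      by blast
  qed
  with assms show ?thesis by simp
next
  case False
  have "y / 4 \<le> 1 / 2"
    using assms pi_less_4 by simp
  also have "1 / 2 = sin (pi / 6)"
    by (simp add: sin_30)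
  also have "\<dots> \<le> sin y"
    using False assms by (intro sin_monotone_2pi_le) auto
  finally show ?thesis .
qed

text \<open>The constant comes from \<open>1 - cos \<theta> = 2 * (sin (\<theta> / 2))^2\<close> and
  the bound \<open>\<bar>\<theta>\<bar> / 8\<close> for the sine:
  \<open>2 / 64 = 1 / 32\<close>.\<close>

lemma one_minus_cos_ge:
  assumes "\<bar>\<theta>\<bar> \<le> pi"
  shows "\<theta>\<^sup>2 / 32 \<le> 1 - cos \<theta>"
proof -
  have "\<bar>\<theta>\<bar> / 8 \<le> sin (\<bar>\<theta>\<bar> / 2)"
    using sin_ge_quarter[of "\<bar>\<theta>\<bar> / 2"] assms by simp
  then have "(\<bar>\<theta>\<bar> / 8)\<^sup>2 \<le> (sin (\<bar>\<theta>\<bar> / 2))\<^sup>2"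
    by (intro power_mono) auto
  moreover have "cos \<bar>\<theta>\<bar> = 1 - 2 * (sin (\<bar>\<theta>\<bar> / 2))\<^sup>2"
    using cos_double_sin[of "\<bar>\<theta>\<bar> / 2"] by simp
  moreover have "cos \<bar>\<theta>\<bar> = cos \<theta>"
    by (simp add: abs_if)
  ultimately show ?thesis
    by (simp add: power_divide)
qed

text \<open>With \<open>r = 1 - \<epsilon>\<close> the squared modulus is
  \<open>(1 - r)^2 + 2 * r * (1 - cos (\<epsilon> * x))\<close>, and
  \<open>\<epsilon> \<le> 1 / 2\<close> ensures \<open>2 * r \<ge> 1\<close>. The bound holds on the
  entire rescaled circle and so supplies an integrable majorant.\<close>

lemma cmod_one_minus_cis_ge:
  assumes e: "0 < \<epsilon>" "\<epsilon> \<le> 1 / 2" and x: "\<bar>\<epsilon> * x\<bar> \<le> pi"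
  shows "\<epsilon>\<^sup>2 * (1 + x\<^sup>2) / 32 \<le> (cmod (1 - of_real (1 - \<epsilon>) * cis (\<epsilon> * x)))\<^sup>2"
proof -
  have "\<epsilon>\<^sup>2 * (1 + x\<^sup>2) / 32 = \<epsilon>\<^sup>2 / 32 + (\<epsilon> * x)\<^sup>2 / 32"
    by (simp add: power_mult_distrib algebra_simps)
  also have "\<dots> \<le> \<epsilon>\<^sup>2 + 2 * (1 - \<epsilon>) * (1 - cos (\<epsilon> * x))"
  proof (intro add_mono)
    show "\<epsilon>\<^sup>2 / 32 \<le> \<epsilon>\<^sup>2" by simp
    have "(\<epsilon> * x)\<^sup>2 / 32 \<le> 1 * (1 - cos (\<epsilon> * x))"
      using one_minus_cos_ge[OF x] by simp
    also have "\<dots> \<le> 2 * (1 - \<epsilon>) * (1 - cos (\<epsilon> * x))"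
      using e by (intro mult_right_mono) auto
    finally show "(\<epsilon> * x)\<^sup>2 / 32 \<le> 2 * (1 - \<epsilon>) * (1 - cos (\<epsilon> * x))" .
  qed
  also have "\<dots> = (1 - (1 - \<epsilon>) * cos (\<epsilon> * x))\<^sup>2 + ((1 - \<epsilon>) * sin (\<epsilon> * x))\<^sup>2"
    unfolding power_mult_distrib sin_squared_eq by (simp add: power2_eq_square algebra_simps)
  also have "\<dots> = (cmod (1 - of_real (1 - \<epsilon>) * cis (\<epsilon> * x)))\<^sup>2"
    by (simp add: cmod_power2)
  finally show ?thesis .
qed

text \<open>The modulus of the argument lies between \<open>\<epsilon>\<close> and 2. Since
  \<open>\<epsilon> \<le> 1 / 3\<close> and \<open>exp 1 \<le> 3\<close>,
  \<open>\<bar>ln \<epsilon>\<bar>\<close> is at least 1 and absorbs both the upper bound for the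
  real part and the bound \<open>pi\<close> for the imaginary part.\<close>

lemma cmod_Ln_one_minus_le:
  assumes e: "0 < \<epsilon>" "\<epsilon> \<le> 1 / 3" and z: "cmod z = 1"
  shows "cmod (Ln (1 - of_real (1 - \<epsilon>) * z)) \<le> (1 + pi) * \<bar>ln \<epsilon>\<bar>"
proof -
  define v where "v = 1 - of_real (1 - \<epsilon>) * z"
  have n: "cmod (of_real (1 - \<epsilon>) * z) = 1 - \<epsilon>"
    using e z by (simp add: norm_mult del: of_real_diff)
  have "\<epsilon> \<le> cmod v"
    using norm_triangle_ineq2[of 1 "of_real (1 - \<epsilon>) * z"] n by (simp add: v_def)
  have "cmod v \<le> 2"
    using norm_triangle_ineq4[of 1 "of_real (1 - \<epsilon>) * z"] n e by (simp add: v_def)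
  have "v \<noteq> 0"
    using \<open>\<epsilon> \<le> cmod v\<close> e by auto
  have "1 \<le> ln (3::real)"
    using exp_le by (simp add: ln_ge_iff)
  also have "\<dots> \<le> - ln \<epsilon>"
    using e ln_mono[of \<epsilon> "1 / 3"] by (simp add: ln_div)
  finally have l: "1 \<le> - ln \<epsilon>" .
  have "\<bar>ln (cmod v)\<bar> \<le> - ln \<epsilon>"
  proof -
    have "ln \<epsilon> \<le> ln (cmod v)"
      using \<open>\<epsilon> \<le> cmod v\<close> e by (intro ln_mono) auto
    moreover have "ln (cmod v) \<le> 1"
      using ln_le_minus_one[of "cmod v"] \<open>cmod v \<le> 2\<close> \<open>v \<noteq> 0\<close> by simp
    ultimately show ?thesis using l by linarith
  qed
  moreover have "\<bar>Im (Ln v)\<bar> \<le> pi * - ln \<epsilon>"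
  proof -
    have "\<bar>Im (Ln v)\<bar> \<le> pi * 1"
      using mpi_less_Im_Ln[OF \<open>v \<noteq> 0\<close>] Im_Ln_le_pi[OF \<open>v \<noteq> 0\<close>] by simp
    also have "\<dots> \<le> pi * - ln \<epsilon>"
      using l by (intro mult_left_mono) auto
    finally show ?thesis .
  qed
  moreover have "cmod (Ln v) \<le> \<bar>Re (Ln v)\<bar> + \<bar>Im (Ln v)\<bar>"
    by (rule cmod_le)
  ultimately have "cmod (Ln v) \<le> - ln \<epsilon> + pi * - ln \<epsilon>"
    using \<open>v \<noteq> 0\<close> by simp
  then show ?thesis
    using l by (simp add: v_def algebra_simps)
qed

text \<open>The expression equals \<open>cis (e n * x) - (cis (e n * x) - 1) / e n\<close>, and the
  last quotient is a difference quotient of \<open>exp (\<i> * x * h)\<close> at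
  \<open>h = 0\<close>.\<close>

lemma tendsto_one_minus_cis_over:
  assumes e: "\<And>n. e n > 0" "e \<longlonglongrightarrow> 0"
  shows "(\<lambda>n. (1 - of_real (1 - e n) * cis (e n * x)) / of_real (e n)) \<longlonglongrightarrow> 1 - \<i> * of_real x"
proof -
  have e': "(\<lambda>n. complex_of_real (e n)) \<longlonglongrightarrow> 0"
    using tendsto_of_real[OF e(2), where 'a=complex] by simp
  have "((\<lambda>h. exp (\<i> * of_real x * h)) has_field_derivative \<i> * of_real x) (at 0)"
    by (auto intro!: derivative_eq_intros)
  then have "((\<lambda>h. (exp (\<i> * of_real x * h) - 1) / h) \<longlongrightarrow> \<i> * of_real x) (at 0)"
    by (simp add: DERIV_def)
  moreover have "filterlim (\<lambda>n. complex_of_real (e n)) (at 0) sequentially"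
    using e' e(1) by (auto simp: filterlim_at intro!: always_eventually dest: less_imp_neq[symmetric])
  ultimately have "(\<lambda>n. (exp (\<i> * of_real x * of_real (e n)) - 1) / of_real (e n)) \<longlonglongrightarrow> \<i> * of_real x"
    by (rule filterlim_compose)
  then have lim: "(\<lambda>n. (cis (e n * x) - 1) / of_real (e n)) \<longlonglongrightarrow> \<i> * of_real x"
    by (simp add: cis_conv_exp mult_ac)
  have "(\<lambda>n. cis (e n * x)) \<longlonglongrightarrow> cis (0 * x)"
    using e(2) by (intro tendsto_intros)
  from tendsto_diff[OF this lim]
  have "(\<lambda>n. cis (e n * x) - (cis (e n * x) - 1) / of_real (e n)) \<longlonglongrightarrow> 1 - \<i> * of_real x"
    by simp
  moreover have "cis (e n * x) - (cis (e n * x) - 1) / of_real (e n)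
      = (1 - of_real (1 - e n) * cis (e n * x)) / of_real (e n)" for n
    using e(1)[of n] by (simp add: field_simps)
  ultimately show ?thesis by simp
qed

text \<open>Factoring out the positive real \<open>e n\<close> splits the logarithm exactly into
  \<open>ln (e n) + Ln (v n)\<close>. The second summand converges, as \<open>v n\<close> tends to a
  point of the right half-plane, and is negligible against \<open>ln (e n)\<close>.\<close>

lemma tendsto_Ln_one_minus_cis_over:
  assumes e: "\<And>n. e n > 0" "e \<longlonglongrightarrow> 0"
  shows "(\<lambda>n. Ln (1 - of_real (1 - e n) * cis (e n * x)) / of_real (ln (e n))) \<longlonglongrightarrow> 1"
proof -
  define v where "v n = (1 - of_real (1 - e n) * cis (e n * x)) / of_real (e n)" for n
  have v: "v \<longlonglongrightarrow> 1 - \<i> * of_real x"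
    unfolding v_def by (rule tendsto_one_minus_cis_over[OF e])
  have "1 - \<i> * of_real x \<noteq> 0"
    by (simp add: complex_eq_iff)
  then have v0: "\<forall>\<^sub>F n in sequentially. v n \<noteq> 0"
    using v by (rule tendsto_imp_eventually_ne[rotated])
  have "filterlim e (at_right 0) sequentially"
    using e by (auto simp: filterlim_at intro!: always_eventually dest: less_imp_neq[symmetric])
  then have "filterlim (\<lambda>n. ln (e n)) at_bot sequentially"
    by (rule filterlim_compose[OF ln_at_0])
  then have ln_bot: "filterlim (\<lambda>n. complex_of_real (ln (e n))) at_infinity sequentially"
    using filterlim_mono[OF _ at_bot_le_at_infinity order_refl]
    by (fastforce simp: filterlim_at_infinity_conv_norm_at_top)
  have "(\<lambda>n. Ln (v n)) \<longlonglongrightarrow> Ln (1 - \<i> * of_real x)"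
    by (intro tendsto_Ln v) (auto simp: complex_nonpos_Reals_iff)
  then have "(\<lambda>n. Ln (v n) / of_real (ln (e n))) \<longlonglongrightarrow> 0"
    using ln_bot by (rule tendsto_divide_0)
  from tendsto_add[OF tendsto_const[of 1] this]
  have "(\<lambda>n. 1 + Ln (v n) / of_real (ln (e n))) \<longlonglongrightarrow> 1"
    by simp
  moreover have "\<forall>\<^sub>F n in sequentially. 1 + Ln (v n) / of_real (ln (e n))
      = Ln (1 - of_real (1 - e n) * cis (e n * x)) / of_real (ln (e n))"
  proof -
    \<comment> \<open>Excludes \<open>e n = 1\<close>, where the quotient would be a division by
      zero.\<close>
    have "\<forall>\<^sub>F n in sequentially. ln (e n) < 0"
      using \<open>filterlim (\<lambda>n. ln (e n)) at_bot sequentially\<close> by (simp add: filterlim_at_bot_dense)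
    with v0 show ?thesis
    proof eventually_elim
      case (elim n)
      have "1 - of_real (1 - e n) * cis (e n * x) = of_real (e n) * v n"
        using e(1)[of n] by (simp add: v_def)
      moreover have "Ln (of_real (e n) * v n) = of_real (ln (e n)) + Ln (v n)"
        using Ln_times_of_real[OF e(1) elim(1)] Ln_of_real[OF e(1)[of n]] by simp
      ultimately show ?case
        using elim by (simp add: field_simps)
    qed
  qed
  ultimately show ?thesis
    by (rule Lim_transform_eventually)
qed

section \<open>Rescaling at the jump\<close>

text \<open>The sign \<open>\<sigma>\<close> treats both sides of the jump together. For each scale
  \<open>e n\<close> and accuracy \<open>1 / Suc m\<close> the exceptional set is the preimage of a
  null set under scaling, hence null; there are only countably many.\<close>

lemma AE_tendsto_rescaled:
  fixes b :: "real \<Rightarrow> complex"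
  assumes [measurable]: "b \<in> borel_measurable borel"
    and ae: "\<And>m::nat. \<exists>\<delta>>0. AE \<theta> in lborel. 0 < \<sigma> * \<theta> \<and> \<sigma> * \<theta> < \<delta> \<longrightarrow> cmod (b \<theta> - d) \<le> 1 / real (Suc m)"
    and e: "\<And>n. e n > 0" "e \<longlonglongrightarrow> 0"
  shows "AE x in lborel. 0 < \<sigma> * x \<longrightarrow> (\<lambda>n. b (e n * x)) \<longlonglongrightarrow> d"
proof -
  have "\<forall>m::nat. \<exists>\<delta>. \<delta> > 0 \<and>
      (AE \<theta> in lborel. 0 < \<sigma> * \<theta> \<and> \<sigma> * \<theta> < \<delta> \<longrightarrow> cmod (b \<theta> - d) \<le> 1 / real (Suc m))"
    using ae by (intro allI)
  from choice[OF this] obtain \<delta> :: "nat \<Rightarrow> real" where \<delta>: "\<And>m. \<delta> m > 0" and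
    ae': "\<And>m. AE \<theta> in lborel. 0 < \<sigma> * \<theta> \<and> \<sigma> * \<theta> < \<delta> m \<longrightarrow> cmod (b \<theta> - d) \<le> 1 / real (Suc m)"
    by blast
  have "AE x in lborel. 0 < \<sigma> * (e n * x) \<and> \<sigma> * (e n * x) < \<delta> m \<longrightarrow>
      cmod (b (e n * x) - d) \<le> 1 / real (Suc m)" for n m
  proof -
    have "AE x in lborel. 0 < \<sigma> * (0 + e n * x) \<and> \<sigma> * (0 + e n * x) < \<delta> m \<longrightarrow>
      cmod (b (0 + e n * x) - d) \<le> 1 / real (Suc m)"
      by (rule AE_borel_affine[OF _ _ ae']) (use e(1)[of n] in auto)
    then show ?thesis by simp
  qed
  then have "AE x in lborel. \<forall>n m. 0 < \<sigma> * (e n * x) \<and> \<sigma> * (e n * x) < \<delta> m \<longrightarrow>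
      cmod (b (e n * x) - d) \<le> 1 / real (Suc m)"
    by (simp add: AE_all_countable)
  then show ?thesis
  proof eventually_elim
    case (elim x)
    show ?case
    proof
      assume x: "0 < \<sigma> * x"
      show "(\<lambda>n. b (e n * x)) \<longlonglongrightarrow> d"
      proof (rule tendstoI)
        fix r :: real assume "r > 0"
        then obtain m where m: "1 / real (Suc m) < r"
          using reals_Archimedean by (auto simp: inverse_eq_divide)
        have "(\<lambda>n. \<sigma> * (e n * x)) \<longlonglongrightarrow> \<sigma> * (0 * x)"
          by (intro tendsto_intros e)
        then have "\<forall>\<^sub>F n in sequentially. \<sigma> * (e n * x) < \<delta> m"
          using \<delta>[of m] by (intro order_tendstoD) auto
        then show "\<forall>\<^sub>F n in sequentially. dist (b (e n * x)) d < r"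
        proof eventually_elim
          fix n assume "\<sigma> * (e n * x) < \<delta> m"
          moreover have "0 < \<sigma> * (e n * x)"
            using mult_pos_pos[OF e(1)[of n] x] by (simp add: mult.left_commute)
          ultimately show "dist (b (e n * x)) d < r"
            using elim[rule_format, of n m] m by (simp add: dist_norm)
        qed
      qed
    qed
  qed
qed

lemma AE_le_of_esssup_tendsto:
  fixes b :: "real \<Rightarrow> complex" and S :: "real \<Rightarrow> real set"
  assumes "((\<lambda>\<delta>. esssup (restrict_space lborel (S \<delta>)) (\<lambda>\<theta>. ereal (cmod (b \<theta> - d)))) \<longlongrightarrow> 0) (at_right 0)"
    and "\<And>\<delta>. S \<delta> \<in> sets borel" and "r > 0"
  shows "\<exists>\<delta>>0. AE \<theta> in lborel. \<theta> \<in> S \<delta> \<longrightarrow> cmod (b \<theta> - d) \<le> r"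
proof -
  have "\<forall>\<^sub>F \<delta> in at_right 0. esssup (restrict_space lborel (S \<delta>)) (\<lambda>\<theta>. ereal (cmod (b \<theta> - d))) < ereal r"
    using assms(1) by (rule order_tendstoD) (use \<open>r > 0\<close> in simp)
  then obtain c where "c > 0" and
    c: "\<And>\<delta>. 0 < \<delta> \<Longrightarrow> \<delta> < c \<Longrightarrow> esssup (restrict_space lborel (S \<delta>)) (\<lambda>\<theta>. ereal (cmod (b \<theta> - d))) < ereal r"
    by (auto simp: eventually_at_right_field)
  define \<delta> where "\<delta> = c / 2"
  have \<delta>: "0 < \<delta>" "\<delta> < c"
    using \<open>c > 0\<close> by (auto simp: \<delta>_def)
  have "AE \<theta> in restrict_space lborel (S \<delta>). ereal (cmod (b \<theta> - d))
      \<le> esssup (restrict_space lborel (S \<delta>)) (\<lambda>\<theta>. ereal (cmod (b \<theta> - d)))"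
    by (rule esssup_AE)
  then have "AE \<theta> in restrict_space lborel (S \<delta>). cmod (b \<theta> - d) \<le> r"
  proof eventually_elim
    case (elim \<theta>)
    then have "ereal (cmod (b \<theta> - d)) < ereal r"
      using c[OF \<delta>] by (rule le_less_trans)
    then show ?case by simp
  qed
  then have "AE \<theta> in lborel. \<theta> \<in> S \<delta> \<longrightarrow> cmod (b \<theta> - d) \<le> r"
    using assms(2) by (subst (asm) AE_restrict_space_iff) auto
  with \<delta> show ?thesis by blast
qed

lemma
  assumes a: "a \<in> borel_measurable arc_length" and t: "cmod t = 1"
    and e: "\<And>n. e n > 0" "e \<longlonglongrightarrow> 0"
  shows ess_right_limit_AE_tendsto:
      "ess_right_limit a t d \<Longrightarrow> AE x in lborel. 0 < x \<longrightarrow> (\<lambda>n. a (t * cis (e n * x))) \<longlonglongrightarrow> d"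
    and ess_left_limit_AE_tendsto:
      "ess_left_limit a t c \<Longrightarrow> AE x in lborel. x < 0 \<longrightarrow> (\<lambda>n. a (t * cis (e n * x))) \<longlonglongrightarrow> c"
proof -
  let ?b = "\<lambda>\<theta>. a (t * cis \<theta>)"
  have b: "?b \<in> borel_measurable borel"
    by (rule borel_measurable_rotated_cis[OF a t])
  show "AE x in lborel. 0 < x \<longrightarrow> (\<lambda>n. a (t * cis (e n * x))) \<longlonglongrightarrow> d" if "ess_right_limit a t d"
  proof -
    have "\<exists>\<delta>>0. AE \<theta> in lborel. 0 < 1 * \<theta> \<and> 1 * \<theta> < \<delta> \<longrightarrow> cmod (?b \<theta> - d) \<le> 1 / real (Suc m)" for m
      using AE_le_of_esssup_tendsto[of "\<lambda>\<delta>. {0<..<\<delta>}" ?b d "1 / real (Suc m)"] that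
      by (simp add: ess_right_limit_def)
    from AE_tendsto_rescaled[OF b this e] show ?thesis by simp
  qed
  show "AE x in lborel. x < 0 \<longrightarrow> (\<lambda>n. a (t * cis (e n * x))) \<longlonglongrightarrow> c" if "ess_left_limit a t c"
  proof -
    have "\<exists>\<delta>>0. AE \<theta> in lborel. 0 < (-1) * \<theta> \<and> (-1) * \<theta> < \<delta> \<longrightarrow> cmod (?b \<theta> - c) \<le> 1 / real (Suc m)" for m
      using AE_le_of_esssup_tendsto[of "\<lambda>\<delta>. {-\<delta><..<0}" ?b c "1 / real (Suc m)"] that
      by (simp add: ess_left_limit_def minus_less_iff conj_commute)
    from AE_tendsto_rescaled[OF b this e] show ?thesis by simp
  qed
qed

section \<open>The limiting kernel on the line\<close>

lemma integrable_inverse_one_plus_square: "integrable lborel (\<lambda>x::real. inverse (1 + x\<^sup>2))"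
  using integrable_inverse_1_plus_square by (simp add: set_integrable_def)

lemma cmod_one_minus_ii: "cmod (1 / (1 - \<i> * of_real x)\<^sup>2) = inverse (1 + x\<^sup>2)"
proof -
  have "(cmod (1 - \<i> * of_real x))\<^sup>2 = 1 + x\<^sup>2"
    by (simp add: cmod_power2)
  then show ?thesis
    by (simp add: norm_divide norm_power inverse_eq_divide)
qed

lemma one_minus_ii_nonzero: "1 - \<i> * complex_of_real x \<noteq> 0"
  by (simp add: complex_eq_iff)

lemma continuous_cauchy_kernel: "isCont (\<lambda>x. 1 / (1 - \<i> * complex_of_real x)\<^sup>2) x"
  by (intro continuous_intros) (simp add: one_minus_ii_nonzero)

lemma integrable_cauchy_kernel: "integrable lborel (\<lambda>x. 1 / (1 - \<i> * complex_of_real x)\<^sup>2)"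
proof (rule Bochner_Integration.integrable_bound[OF integrable_inverse_one_plus_square])
  have "continuous_on UNIV (\<lambda>x. 1 / (1 - \<i> * complex_of_real x)\<^sup>2)"
    by (intro continuous_at_imp_continuous_on ballI continuous_cauchy_kernel)
  then show "(\<lambda>x. 1 / (1 - \<i> * complex_of_real x)\<^sup>2) \<in> borel_measurable lborel"
    by (simp add: borel_measurable_continuous_onI)
qed (simp add: cmod_one_minus_ii)

text \<open>The primitive \<open>- \<i> / (1 - \<i> * x)\<close> vanishes at both infinities and
  equals \<open>- \<i>\<close> at 0, so the two half-lines contribute opposite values.\<close>

lemma integral_cauchy_kernel:
  shows "(LINT x|lborel. indicator {0<..} x *\<^sub>R (1 / (1 - \<i> * complex_of_real x)\<^sup>2)) = \<i>" (is ?pos)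
    and "(LINT x|lborel. indicator {..<0} x *\<^sub>R (1 / (1 - \<i> * complex_of_real x)\<^sup>2)) = - \<i>" (is ?neg)
proof -
  define F where "F x = - \<i> / (1 - \<i> * complex_of_real x)" for x
  have deriv: "(F has_vector_derivative 1 / (1 - \<i> * complex_of_real x)\<^sup>2) (at x)" for x
  proof -
    have "((\<lambda>z. - \<i> / (1 - \<i> * z)) has_field_derivative 1 / (1 - \<i> * complex_of_real x)\<^sup>2) (at (of_real x))"
      using one_minus_ii_nonzero[of x] by (auto intro!: derivative_eq_intros simp: power2_eq_square)
    from has_vector_derivative_real_field[OF this] show ?thesis
      by (simp add: F_def[abs_def])
  qed
  have norm_F: "cmod (F x) \<le> 1 / \<bar>x\<bar>" if "x \<noteq> 0" for x
    using abs_Im_le_cmod[of "1 - \<i> * complex_of_real x"] that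
    by (simp add: F_def norm_divide divide_left_mono)
  have top: "((\<lambda>x::real. 1 / \<bar>x\<bar>) \<longlongrightarrow> 0) at_top" and bot: "((\<lambda>x::real. 1 / \<bar>x\<bar>) \<longlongrightarrow> 0) at_bot"
    by real_asymp+
  have F_top: "(F \<longlongrightarrow> 0) at_top"
    by (rule Lim_null_comparison[OF eventually_mono[OF eventually_gt_at_top[of 0]] top])
      (intro norm_F; simp)
  have F_bot: "(F \<longlongrightarrow> 0) at_bot"
    by (rule Lim_null_comparison[OF eventually_mono[OF eventually_gt_at_bot[of 0]] bot])
      (intro norm_F; simp)
  have F_0: "(F \<longlongrightarrow> - \<i>) (at 0)"
  proof -
    have "isCont F 0"
      using deriv[of 0] by (rule has_vector_derivative_continuous)
    then show ?thesis by (simp add: isCont_def F_def)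
  qed
  have F_0r: "(F \<longlongrightarrow> - \<i>) (at_right 0)" and F_0l: "(F \<longlongrightarrow> - \<i>) (at_left 0)"
    using F_0 by (auto intro: tendsto_within_subset)
  have sint: "set_integrable lborel A (\<lambda>x. 1 / (1 - \<i> * complex_of_real x)\<^sup>2)" if "A \<in> sets borel" for A
    unfolding set_integrable_def using that integrable_cauchy_kernel
    by (intro integrable_mult_indicator) auto
  have "(LBINT x=ereal 0..\<infinity>. 1 / (1 - \<i> * complex_of_real x)\<^sup>2) = 0 - (- \<i>)"
  proof (rule interval_integral_FTC_integrable)
    show "((F \<circ> real_of_ereal) \<longlongrightarrow> - \<i>) (at_right (ereal 0))"
      using F_0r by (simp add: ereal_tendsto_simps1 zero_ereal_def)
    show "((F \<circ> real_of_ereal) \<longlongrightarrow> 0) (at_left \<infinity>)"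
      using F_top by (simp add: ereal_tendsto_simps1)
  qed (use deriv continuous_cauchy_kernel in \<open>auto intro!: sint\<close>)
  then show ?pos
    by (simp add: interval_lebesgue_integral_def set_lebesgue_integral_def einterval_def
        greaterThan_def[symmetric])
  have "(LBINT x=-\<infinity>..ereal 0. 1 / (1 - \<i> * complex_of_real x)\<^sup>2) = - \<i> - 0"
  proof (rule interval_integral_FTC_integrable)
    show "((F \<circ> real_of_ereal) \<longlongrightarrow> - \<i>) (at_left (ereal 0))"
      using F_0l by (simp add: ereal_tendsto_simps1 zero_ereal_def)
    show "((F \<circ> real_of_ereal) \<longlongrightarrow> 0) (at_right (-\<infinity>))"
      using F_bot by (simp add: ereal_tendsto_simps1)
  qed (use deriv continuous_cauchy_kernel in \<open>auto intro!: sint\<close>)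
  then show ?neg
    by (simp add: interval_lebesgue_integral_def set_lebesgue_integral_def einterval_def
        lessThan_def[symmetric])
qed

text \<open>The additional factor \<open>\<epsilon>\<close> is the Jacobian of the rescaling.
  Together with the numerator it cancels the \<open>\<epsilon>^2\<close> in the lower bound for the
  denominator.\<close>

lemma cmod_rescaled_kernel_le:
  assumes e: "0 < \<epsilon>" "\<epsilon> \<le> 1 / 2" and x: "\<epsilon> * x \<in> {-pi..<pi}"
  shows "\<epsilon> * cmod (of_real \<epsilon> / (1 - of_real (1 - \<epsilon>) * cis (\<epsilon> * x))\<^sup>2) \<le> 32 * inverse (1 + x\<^sup>2)"
proof -
  let ?V = "1 - complex_of_real (1 - \<epsilon>) * cis (\<epsilon> * x)"
  have pos: "0 < 1 + x\<^sup>2"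
    by (simp add: add_pos_nonneg)
  have ge: "\<epsilon>\<^sup>2 * (1 + x\<^sup>2) / 32 \<le> (cmod ?V)\<^sup>2"
    by (rule cmod_one_minus_cis_ge[OF e]) (use x in auto)
  have pos2: "0 < \<epsilon>\<^sup>2 * (1 + x\<^sup>2) / 32"
    using e pos by simp
  have "\<epsilon> * cmod (of_real \<epsilon> / ?V\<^sup>2) = \<epsilon>\<^sup>2 / (cmod ?V)\<^sup>2"
    using e by (simp add: norm_divide norm_power power2_eq_square[of \<epsilon>])
  also have "\<dots> \<le> \<epsilon>\<^sup>2 / (\<epsilon>\<^sup>2 * (1 + x\<^sup>2) / 32)"
    by (rule divide_left_mono[OF ge _ mult_pos_pos[OF order_less_le_trans[OF pos2 ge] pos2]]) simp
  also have "\<dots> = 32 * inverse (1 + x\<^sup>2)"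
    using e by (simp add: inverse_eq_divide)
  finally show ?thesis .
qed

section \<open>Test functions and the asymptotics of the pairing\<close>

definition test_point :: "complex \<Rightarrow> real \<Rightarrow> complex" where
  "test_point t \<epsilon> = of_real (1 - \<epsilon>) * cnj t"

text \<open>A multiple of the squared Szego kernel. Its pole \<open>t / (1 - \<epsilon>)\<close>
  lies just outside the circle and approaches \<open>t\<close>; the numerator keeps the
  \<open>L^1\<close> norm bounded.\<close>

definition test_fun :: "complex \<Rightarrow> real \<Rightarrow> complex \<Rightarrow> complex" where
  "test_fun t \<epsilon> z = of_real \<epsilon> / (1 - test_point t \<epsilon> * z)\<^sup>2"

lemma cmod_test_point: "cmod t = 1 \<Longrightarrow> 0 < \<epsilon> \<Longrightarrow> \<epsilon> < 1 \<Longrightarrow> cmod (test_point t \<epsilon>) < 1"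
  by (simp add: test_point_def norm_mult del: of_real_diff)

lemma test_point_mult:
  assumes t: "cmod t = 1"
  shows "test_point t \<epsilon> * (t * cis \<theta>) = of_real (1 - \<epsilon>) * cis \<theta>"
proof -
  have "test_point t \<epsilon> * (t * cis \<theta>) = of_real (1 - \<epsilon>) * (t * cnj t) * cis \<theta>"
    by (simp add: test_point_def mult_ac)
  also have "t * cnj t = 1"
    using complex_norm_square[of t] t by simp
  finally show ?thesis by simp
qed

lemma test_fun_L1_bound:
  assumes t: "cmod t = 1" and e: "0 < \<epsilon>" "\<epsilon> \<le> 1 / 2"
  shows "(LINT z|arc_length. cmod (test_fun t \<epsilon> z)) \<le> (LINT x|lborel. 32 * inverse (1 + x\<^sup>2))"
proof -
  have "continuous_on (sphere 0 1) (test_fun t \<epsilon>)"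
    unfolding test_fun_def using e by (intro hardy_2_inverse_square(1) cmod_test_point t) auto
  then have meas: "(\<lambda>z. cmod (test_fun t \<epsilon> z)) \<in> borel_measurable arc_length"
    by (intro continuous_on_imp_borel_measurable_arc_length continuous_on_norm)
  have "(LINT z|arc_length. cmod (test_fun t \<epsilon> z))
      = (LINT x|lborel. \<epsilon> * (indicator {-pi..<pi} (\<epsilon> * x) *\<^sub>R cmod (test_fun t \<epsilon> (t * cis (\<epsilon> * x)))))"
    by (subst integral_arc_length_rescaled[OF meas t e(1)]) simp
  also have "\<dots> \<le> (LINT x|lborel. 32 * inverse (1 + x\<^sup>2))"
  proof (rule integral_mono')
    show "integrable lborel (\<lambda>x::real. 32 * inverse (1 + x\<^sup>2))"
      using integrable_inverse_one_plus_square by (rule integrable_mult_right)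
    fix x :: real
    show "0 \<le> 32 * inverse (1 + x\<^sup>2)" by simp
    then show "\<epsilon> * (indicator {-pi..<pi} (\<epsilon> * x) *\<^sub>R cmod (test_fun t \<epsilon> (t * cis (\<epsilon> * x))))
        \<le> 32 * inverse (1 + x\<^sup>2)"
      using cmod_rescaled_kernel_le[OF e, of x]
      by (cases "\<epsilon> * x \<in> {-pi..<pi}") (auto simp: test_fun_def test_point_mult[OF t])
  qed
  finally show ?thesis .
qed

text \<open>Dominated convergence for the rescaled integrand: the logarithm divided by
  \<open>ln (e n)\<close> is bounded by \<open>1 + pi\<close> and tends to 1, leaving the kernel
  weighted by \<open>d\<close> on the right and \<open>c\<close> on the left.\<close>

lemma tendsto_pairing_at_jump:
  assumes t: "cmod t = 1" and a: "a \<in> circle_Linfty"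
    and c: "ess_left_limit a t c" and d: "ess_right_limit a t d"
    and e: "\<And>n. 0 < e n" "\<And>n. e n \<le> 1 / 3" "e \<longlonglongrightarrow> 0"
  shows "(\<lambda>n. (LINT z|arc_length. a z * test_fun t (e n) z * cnj (Ln (1 - test_point t (e n) * z)))
      / of_real (ln (e n))) \<longlonglongrightarrow> \<i> * (d - c)"
proof -
  define F where "F n z = a z * test_fun t (e n) z * cnj (Ln (1 - test_point t (e n) * z))" for n z
  \<comment> \<open>The numerator \<open>e n\<close> is the Jacobian; the denominator is the
    normalisation in the claim.\<close>
  define S where "S n x = (of_real (e n) / of_real (ln (e n)))
    * (indicator {-pi..<pi} (e n * x) *\<^sub>R F n (t * cis (e n * x)))" for n x
  define K where "K x = 1 / (1 - \<i> * complex_of_real x)\<^sup>2" for x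
  define J where "J x = d * (indicator {0<..} x *\<^sub>R K x) + c * (indicator {..<0} x *\<^sub>R K x)" for x
  have a_meas: "a \<in> borel_measurable arc_length"
    using a by (rule circle_LinftyD)
  obtain M where M: "M \<ge> 0" "AE z in arc_length. cmod (a z) \<le> M"
    using circle_LinftyD(2)[OF a] by blast
  have q: "cmod (test_point t (e n)) < 1" for n
    using e(1,2)[of n] by (intro cmod_test_point t) auto
  have F_meas: "F n \<in> borel_measurable arc_length" for n
    unfolding F_def test_fun_def
    by (intro borel_measurable_times a_meas continuous_on_imp_borel_measurable_arc_length
        hardy_2_inverse_square(1) continuous_on_cnj Ln_one_minus_power_series(1) q)
  have S_meas: "S n \<in> borel_measurable lborel" for n
  proof -
    note [measurable] = borel_measurable_rotated_cis[OF F_meas[of n] t]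
    have "(\<lambda>x. indicator {-pi..<pi} x *\<^sub>R F n (t * cis x)) \<in> borel_measurable borel"
      by measurable
    from measurable_compose[OF _ this, of "\<lambda>x. e n * x" borel]
    show ?thesis unfolding S_def by simp
  qed
  have S_int: "(LINT z|arc_length. F n z) / of_real (ln (e n)) = (LINT x|lborel. S n x)" for n
    unfolding integral_arc_length_rescaled[OF F_meas t e(1)[of n]] S_def integral_mult_right_zero
    by (simp add: scaleR_conv_of_real)
  have F_eq: "F n (t * cis (e n * x)) = a (t * cis (e n * x))
      * (of_real (e n) / (1 - of_real (1 - e n) * cis (e n * x))\<^sup>2)
      * cnj (Ln (1 - of_real (1 - e n) * cis (e n * x)))" for n x
    by (simp add: F_def test_fun_def test_point_mult[OF t])
  have ln_neg: "ln (e n) < 0" for n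
    using e(1,2)[of n] by simp
  have bound: "AE x in lborel. norm (S n x) \<le> M * (1 + pi) * (32 * inverse (1 + x\<^sup>2))" for n
  proof -
    note [measurable] = borel_measurable_rotated_cis[OF a_meas t]
    have "AE x in lborel. 0 + e n * x \<in> {-pi..<pi} \<longrightarrow> cmod (a (t * cis (0 + e n * x))) \<le> M"
      by (rule AE_borel_affine[OF _ _ AE_arc_length_rotated[OF M(2) t]]) (use e(1)[of n] in auto)
    then show ?thesis
    proof eventually_elim
      case (elim x)
      show ?case
      proof (cases "e n * x \<in> {-pi..<pi}")
        case True
        let ?V = "1 - complex_of_real (1 - e n) * cis (e n * x)"
        have "norm (S n x) = cmod (a (t * cis (e n * x))) * (cmod (Ln ?V) / \<bar>ln (e n)\<bar>)
            * (e n * cmod (of_real (e n) / ?V\<^sup>2))"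
          unfolding S_def F_eq using True e(1)[of n]
          by (simp add: norm_mult norm_divide mult_ac del: of_real_diff)
        also have "\<dots> \<le> M * (1 + pi) * (32 * inverse (1 + x\<^sup>2))"
        proof (rule mult_mono[OF mult_mono])
          show "cmod (a (t * cis (e n * x))) \<le> M"
            using elim True by simp
          show "cmod (Ln ?V) / \<bar>ln (e n)\<bar> \<le> 1 + pi"
            using cmod_Ln_one_minus_le[OF e(1,2)[of n], of "cis (e n * x)"] ln_neg[of n]
            by (intro mult_imp_div_pos_le) auto
          show "e n * cmod (of_real (e n) / ?V\<^sup>2) \<le> 32 * inverse (1 + x\<^sup>2)"
            using e(1,2)[of n] True by (intro cmod_rescaled_kernel_le) auto
        qed (use M(1) e(1)[of n] in \<open>auto intro!: mult_nonneg_nonneg\<close>)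
        finally show ?thesis .
      next
        case False
        then show ?thesis using M(1) by (simp add: S_def)
      qed
    qed
  qed
  have lim: "AE x in lborel. (\<lambda>n. S n x) \<longlonglongrightarrow> J x"
    using ess_right_limit_AE_tendsto[OF a_meas t e(1,3) d] ess_left_limit_AE_tendsto[OF a_meas t e(1,3) c]
      AE_lborel_singleton[of 0]
  proof eventually_elim
    case (elim x)
    define l where "l = (if x > 0 then d else c)"
    have la: "(\<lambda>n. a (t * cis (e n * x))) \<longlonglongrightarrow> l"
      using elim by (auto simp: l_def)
    \<comment> \<open>The Jacobian and the numerator of \<open>test_fun\<close> each provide one
      factor \<open>e n\<close>; together they turn \<open>1 - (1 - e n) * cis (e n * x)\<close>
      inside the square into its convergent quotient by \<open>e n\<close>.\<close>
    have "(\<lambda>n. a (t * cis (e n * x))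
        * (1 / ((1 - of_real (1 - e n) * cis (e n * x)) / of_real (e n))\<^sup>2)
        * cnj (Ln (1 - of_real (1 - e n) * cis (e n * x)) / of_real (ln (e n)))) \<longlonglongrightarrow> l * K x * cnj 1"
      unfolding K_def
      by (intro tendsto_mult la tendsto_divide tendsto_const tendsto_power tendsto_cnj
          tendsto_one_minus_cis_over tendsto_Ln_one_minus_cis_over e) (simp add: one_minus_ii_nonzero)
    also have "l * K x * cnj 1 = J x"
      using elim by (auto simp: J_def l_def)
    finally show ?case
    proof (rule Lim_transform_eventually)
      show "\<forall>\<^sub>F n in sequentially. a (t * cis (e n * x))
        * (1 / ((1 - of_real (1 - e n) * cis (e n * x)) / of_real (e n))\<^sup>2)
        * cnj (Ln (1 - of_real (1 - e n) * cis (e n * x)) / of_real (ln (e n))) = S n x"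
      proof -
        \<comment> \<open>For fixed \<open>x\<close> the rescaled point eventually lies in the
          parameter interval, so the indicator in \<open>S n x\<close> becomes 1.\<close>
        have ex: "(\<lambda>n. e n * x) \<longlonglongrightarrow> 0 * x"
          by (intro tendsto_intros e)
        have "\<forall>\<^sub>F n in sequentially. - pi < e n * x" "\<forall>\<^sub>F n in sequentially. e n * x < pi"
          using ex by (auto intro: order_tendstoD)
        then show ?thesis
        proof eventually_elim
          case (elim n)
          then have "e n * x \<in> {-pi..<pi}" by simp
          then show ?case
            unfolding S_def F_eq using e(1)[of n]
            by (simp add: power2_eq_square mult_ac del: of_real_diff)
        qed
      qed
    qed
  qed
  have K_int: "integrable lborel (\<lambda>x. indicator A x *\<^sub>R K x)" if "A \<in> sets borel" for A
    using that integrable_cauchy_kernel unfolding K_def by (intro integrable_mult_indicator) auto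
  have J_int: "integrable lborel J"
    unfolding J_def by (intro Bochner_Integration.integrable_add integrable_mult_right K_int) auto
  have "(LINT x|lborel. J x) = (LINT x|lborel. d * (indicator {0<..} x *\<^sub>R K x))
      + (LINT x|lborel. c * (indicator {..<0} x *\<^sub>R K x))"
    unfolding J_def by (intro Bochner_Integration.integral_add integrable_mult_right K_int) auto
  also have "\<dots> = d * \<i> + c * (- \<i>)"
    unfolding K_def by (simp only: integral_mult_right_zero integral_cauchy_kernel)
  also have "\<dots> = \<i> * (d - c)"
    by (simp add: algebra_simps)
  finally have "(LINT x|lborel. J x) = \<i> * (d - c)" .
  moreover have "(\<lambda>n. LINT x|lborel. S n x) \<longlonglongrightarrow> (LINT x|lborel. J x)"
  proof (rule integral_dominated_convergence)
    show "integrable lborel (\<lambda>x. M * (1 + pi) * (32 * inverse (1 + x\<^sup>2)))"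
      by (intro integrable_mult_right integrable_inverse_one_plus_square)
  qed (use J_int S_meas lim bound in auto)
  ultimately show ?thesis
    unfolding S_int[symmetric] F_def by (simp only:)
qed


theorem theorem6:
  fixes a :: "complex \<Rightarrow> complex"
  assumes "a \<in> circle_Linfty"
    and "toeplitz_bounded_H1 a"
  shows "\<not> (\<exists>t \<in> sphere 0 1. jump_discontinuity_at a t)"
proof safe
  fix t :: complex assume "t \<in> sphere 0 1" "jump_discontinuity_at a t"
  then obtain c d where t: "cmod t = 1" and lim: "ess_left_limit a t c" "ess_right_limit a t d" and "c \<noteq> d"
    by (auto simp: jump_discontinuity_at_def)
  obtain C where C: "\<And>f. f \<in> hardy 2 \<Longrightarrow> circle_Lp_norm 1 (toeplitz a f) \<le> C * circle_Lp_norm 1 f"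
    using assms(2) by (auto simp: toeplitz_bounded_H1_def)
  \<comment> \<open>Starting at \<open>1 / 3\<close> meets the requirement of the logarithm bound
    for every index.\<close>
  define e :: "nat \<Rightarrow> real" where "e n = 1 / real (n + 3)" for n
  have e: "0 < e n" "e n \<le> 1 / 3" for n
    by (auto simp: e_def field_simps)
  have e_lim: "e \<longlonglongrightarrow> 0"
    unfolding e_def by real_asymp
  define I where "I n = (LINT z|arc_length. a z * test_fun t (e n) z * cnj (Ln (1 - test_point t (e n) * z)))" for n
  \<comment> \<open>The sign of \<open>C\<close> is not known; replacing the \<open>L^1\<close> norm
    of the test function by its upper bound needs a non-negative factor.\<close>
  define B where "B = 2 * pi * (\<bar>C\<bar> * (LINT x|lborel. 32 * inverse (1 + x\<^sup>2)))"
  have "cmod (I n) \<le> B" for n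
  proof -
    have q: "cmod (test_point t (e n)) < 1"
      using e[of n] by (intro cmod_test_point t) auto
    have "cmod (I n) \<le> 2 * pi * (C * (LINT z|arc_length. cmod (test_fun t (e n) z)))"
      unfolding I_def test_fun_def
      by (intro toeplitz_pairing_bound assms(1) C q hardy_2_inverse_square)
    also have "\<dots> \<le> 2 * pi * (\<bar>C\<bar> * (LINT z|arc_length. cmod (test_fun t (e n) z)))"
      by (intro mult_left_mono mult_right_mono integral_nonneg_AE) auto
    also have "\<dots> \<le> B"
      unfolding B_def using e[of n] by (intro mult_left_mono test_fun_L1_bound t) auto
    finally show ?thesis .
  qed
  then have "Bseq I"
    by (rule BseqI')
  moreover have "(\<lambda>n. 1 / complex_of_real (ln (e n))) \<longlonglongrightarrow> 0"
  proof -
    have "(\<lambda>n. 1 / ln (e n)) \<longlonglongrightarrow> 0"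
      unfolding e_def by real_asymp
    from tendsto_of_real[OF this, where 'a=complex] show ?thesis by simp
  qed
  \<comment> \<open>A bounded sequence times a null sequence: this is where the unboundedness of
    \<open>ln (e n)\<close> contradicts a jump.\<close>
  ultimately have "(\<lambda>n. I n / of_real (ln (e n))) \<longlonglongrightarrow> 0"
    using bounded_bilinear.Bfun_prod_Zfun[OF bounded_bilinear_mult, of I sequentially
        "\<lambda>n. 1 / complex_of_real (ln (e n))"]
    by (simp add: tendsto_Zfun_iff)
  moreover have "(\<lambda>n. I n / of_real (ln (e n))) \<longlonglongrightarrow> \<i> * (d - c)"
    unfolding I_def by (rule tendsto_pairing_at_jump[OF t assms(1) lim e e_lim])
  ultimately have "\<i> * (d - c) = 0"
    by (rule LIMSEQ_unique[symmetric])
  with \<open>c \<noteq> d\<close> show False by simp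
qed

end
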